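(* There exists a variety of algebras in a finite language, defined by a recursive set of equational laws each of which involves no variables (i.e., each law is an equation between closed terms built from constants), such that the variety has solvable word problem but does not have uniformly solvable word problem.
   Context: Let $\Sigma$ be a finitary algebraic type and $V$ a variety of $\Sigma$-algebras. A presentation is a pair $\mathcal{P}=(X,R)$ with $X$ a set of generators and $R\subseteq FX\times FX$, where $FX$ is the absolutely free $\Sigma$-algebra over $X$; it is finite if $X$ and $R$ are finite. The word problem for $\mathcal{P}$ relative to $V$ is: given $s,t\in FX$, decide whether $(s,t)$ lies in the congruence on $FX$ generated by $R$ together with all equations in variables from $X$ valid in $V$. $V$ has solvable word problem if for each finite presentation $\mathcal{P}$ there exists an algorithm solving the word problem for $\mathcal{P}$ relative to $V$. $V$ has uniformly solvable word problem if there is a single algorithm which, given a finite presentation $\mathcal{P}$ and terms $s,t$, decides the word problem for $\mathcal{P}$ relative to $V$. A finite language means finitely many operation symbols. *)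

theory Defs
  imports Main "HOL-Library.Nat_Bijection" "HOL-Library.Countable_Set"
begin

section \<open>Terms, algebras and varieties\<close>

text \<open>Operation symbols are natural numbers. The arity function is only
  meaningful on the operation symbols of the signature; constants have arity 0.\<close>

record signature =
  ops :: "nat set"
  arity :: "nat \<Rightarrow> nat"

datatype (vars: 'x) trm = Var 'x | Op nat "'x trm list"

type_synonym 'x equation = "'x trm \<times> 'x trm"

primrec trm_code :: "nat trm \<Rightarrow> nat" where
  "trm_code (Var x) = sum_encode (Inl x)"
| "trm_code (Op f ts) = sum_encode (Inr (prod_encode (f, list_encode (map trm_code ts))))"

text \<open>The carrier of the absolutely free algebra over the set \<open>X\<close>.\<close>

inductive_set free_terms :: "signature \<Rightarrow> 'x set \<Rightarrow> 'x trm set"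
  for \<Sigma> :: signature and X :: "'x set" where
  Var: "x \<in> X \<Longrightarrow> Var x \<in> free_terms \<Sigma> X"
| Op: "\<lbrakk>f \<in> ops \<Sigma>; length ts = arity \<Sigma> f; \<And>t. t \<in> set ts \<Longrightarrow> t \<in> free_terms \<Sigma> X\<rbrakk>
    \<Longrightarrow> Op f ts \<in> free_terms \<Sigma> X"

record 'a algebra =
  carrier :: "'a set"
  interp :: "nat \<Rightarrow> 'a list \<Rightarrow> 'a"

text \<open>The empty algebra (possible only without constants) is not excluded. It satisfies every
  equation containing a variable, so it does not affect which equations are valid.\<close>

definition is_algebra :: "signature \<Rightarrow> 'a algebra \<Rightarrow> bool" where
  "is_algebra \<Sigma> A \<longleftrightarrow>
     (\<forall>f\<in>ops \<Sigma>. \<forall>as. length as = arity \<Sigma> f \<and> set as \<subseteq> carrier A \<longrightarrow> interp A f as \<in> carrier A)"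

primrec term_val :: "'a algebra \<Rightarrow> ('x \<Rightarrow> 'a) \<Rightarrow> 'x trm \<Rightarrow> 'a" where
  "term_val A v (Var x) = v x"
| "term_val A v (Op f ts) = interp A f (map (term_val A v) ts)"

definition satisfies :: "'a algebra \<Rightarrow> 'x equation \<Rightarrow> bool" where
  "satisfies A e \<longleftrightarrow>
     (\<forall>v. v ` (vars (fst e) \<union> vars (snd e)) \<subseteq> carrier A \<longrightarrow>
        term_val A v (fst e) = term_val A v (snd e))"

definition variety :: "signature \<Rightarrow> nat equation set \<Rightarrow> 'a algebra set" where
  "variety \<Sigma> E = {A. is_algebra \<Sigma> A \<and> (\<forall>e\<in>E. satisfies A e)}"

definition valid_equations :: "signature \<Rightarrow> 'a algebra set \<Rightarrow> 'x set \<Rightarrow> 'x equation set" where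
  "valid_equations \<Sigma> V X = {e \<in> free_terms \<Sigma> X \<times> free_terms \<Sigma> X. \<forall>A\<in>V. satisfies A e}"

text \<open>Validity in a variety quantifies over its algebras, so the type of their elements has to
  be fixed. Below we take algebras whose carrier is a set of natural numbers. This
  is no restriction: only countably many elements matter for one instance of an equation, so an
  equation valid in all such algebras of a variety is valid in all of its algebras, over any type
  of elements. This is what the following lemma says.\<close>

lemma term_val_in_carrier:
  assumes "is_algebra \<Sigma> A" "t \<in> free_terms \<Sigma> X" "v ` X \<subseteq> carrier A"
  shows "term_val A v t \<in> carrier A"
  using assms(2)
proof (induction t rule: free_terms.induct)
  case (Var x)
  then show ?case using assms(3) by auto
next
  case (Op f ts)
  then have "set (map (term_val A v) ts) \<subseteq> carrier A" by auto
  then show ?case using assms(1) Op.hyps by (simp add: is_algebra_def)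
qed

lemma inj_trm_code: "inj trm_code"
proof -
  have "s = t" if "trm_code s = trm_code t" for s t
    using that
  proof (induction s arbitrary: t)
    case (Var x)
    then show ?case by (cases t) (auto simp: sum_encode_eq)
  next
    case (Op f ts)
    then obtain us where t: "t = Op f us" "map trm_code ts = map trm_code us"
      by (cases t) (auto simp: sum_encode_eq prod_encode_eq list_encode_eq)
    have "ts = us"
    proof (rule nth_equalityI)
      show len: "length ts = length us"
        using t(2) by (rule map_eq_imp_length_eq)
      fix k assume k: "k < length ts"
      then have "trm_code (ts ! k) = trm_code (us ! k)"
        using t(2) len by (metis nth_map)
      then show "ts ! k = us ! k"
        using Op.IH nth_mem[OF k] by blast
    qed
    then show ?case using t by simp
  qed
  then show ?thesis by (auto simp: inj_def)
qed

lemma countable_trm: "countable (UNIV :: nat trm set)"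
  using inj_trm_code by (auto simp: countable_def)

lemma valid_in_all_carrier_types:
  fixes A :: "'a algebra" and X :: "nat set"
  assumes laws: "E \<subseteq> free_terms \<Sigma> UNIV \<times> free_terms \<Sigma> UNIV"
    and valid: "e \<in> valid_equations \<Sigma> (variety \<Sigma> E :: nat algebra set) X"
    and A: "A \<in> variety \<Sigma> E"
  shows "satisfies A e"
  unfolding satisfies_def
proof (intro allI impI)
  fix v :: "nat \<Rightarrow> 'a"
  define W where "W = vars (fst e) \<union> vars (snd e)"
  assume "v ` (vars (fst e) \<union> vars (snd e)) \<subseteq> carrier A"
  then have v: "v ` W \<subseteq> carrier A" by (simp add: W_def)
  have algA: "is_algebra \<Sigma> A" and satA: "\<And>e'. e' \<in> E \<Longrightarrow> satisfies A e'"
    using A by (auto simp: variety_def)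
  define C where "C = term_val A v ` free_terms \<Sigma> W"
  have C_sub: "C \<subseteq> carrier A"
    using term_val_in_carrier[OF algA _ v] by (auto simp: C_def)
  have "countable C"
    unfolding C_def by (rule countable_image) (rule countable_subset[OF subset_UNIV countable_trm])
  define i where "i = to_nat_on C"
  define j where "j = from_nat_into C"
  have ji: "j (i c) = c" if "c \<in> C" for c
    using that \<open>countable C\<close> by (simp add: i_def j_def)
  have vC: "v x \<in> C" if "x \<in> W" for x
    using that by (force simp: C_def intro: free_terms.Var)
  have C_closed: "interp A f as \<in> C"
    if f: "f \<in> ops \<Sigma>" "length as = arity \<Sigma> f" and as: "set as \<subseteq> C" for f as
  proof -
    have "\<forall>a\<in>set as. \<exists>t. t \<in> free_terms \<Sigma> W \<and> term_val A v t = a"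
      using as by (auto simp: C_def)
    then obtain g where g: "\<And>a. a \<in> set as \<Longrightarrow> g a \<in> free_terms \<Sigma> W \<and> term_val A v (g a) = a"
      by metis
    have "Op f (map g as) \<in> free_terms \<Sigma> W"
      using f g by (auto intro!: free_terms.Op)
    moreover have "map (term_val A v \<circ> g) as = as"
      using g by (intro map_idI) auto
    then have "term_val A v (Op f (map g as)) = interp A f as" by simp
    ultimately show ?thesis unfolding C_def by (metis imageI)
  qed
  define B :: "nat algebra" where
    "B = \<lparr>carrier = i ` C, interp = (\<lambda>f as. i (interp A f (map j as)))\<rparr>"
  have interp_B: "interp B f as = i (interp A f (map j as))" for f as
    by (simp add: B_def)
  have algB: "is_algebra \<Sigma> B"
    unfolding is_algebra_def
  proof (intro ballI allI impI)
    fix f as assume f: "f \<in> ops \<Sigma>" and as: "length as = arity \<Sigma> f \<and> set as \<subseteq> carrier B"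
    have "set (map j as) \<subseteq> C" using as ji by (auto simp: B_def)
    then have "interp A f (map j as) \<in> C" using C_closed f as by simp
    then show "interp B f as \<in> carrier B" by (simp add: B_def)
  qed
  have val: "term_val A w t \<in> C \<and> term_val B (i \<circ> w) t = i (term_val A w t)"
    if t: "t \<in> free_terms \<Sigma> Y" and "w ` vars t \<subseteq> C" for t Y and w :: "nat \<Rightarrow> 'a"
    using t that(2)
  proof (induction t rule: free_terms.induct)
    case (Var x)
    then show ?case by auto
  next
    case (Op f ts)
    have IH: "term_val A w t \<in> C \<and> term_val B (i \<circ> w) t = i (term_val A w t)" if "t \<in> set ts" for t
    proof (rule Op.IH[OF that])
      show "w ` vars t \<subseteq> C" using Op.prems that by auto
    qed
    have "interp A f (map (term_val A w) ts) \<in> C"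
      by (rule C_closed) (use Op.hyps IH in auto)
    moreover have "map (j \<circ> term_val B (i \<circ> w)) ts = map (term_val A w) ts"
      using IH ji by auto
    moreover have "term_val B (i \<circ> w) (Op f ts)
        = i (interp A f (map (j \<circ> term_val B (i \<circ> w)) ts))"
      by (simp add: interp_B)
    ultimately show ?case by (metis term_val.simps(2))
  qed
  have "satisfies B e'" if "e' \<in> E" for e'
    unfolding satisfies_def
  proof (intro allI impI)
    fix w :: "nat \<Rightarrow> nat"
    assume w: "w ` (vars (fst e') \<union> vars (snd e')) \<subseteq> carrier B"
    define w' where "w' = j \<circ> w"
    have w': "w' x \<in> C \<and> i (w' x) = w x" if "x \<in> vars (fst e') \<union> vars (snd e')" for x
    proof -
      have "w x \<in> i ` C" using w that by (auto simp: B_def)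
      then obtain c where "c \<in> C" "w x = i c" by auto
      then show ?thesis using ji by (simp add: w'_def)
    qed
    have cong: "term_val B w t = term_val B (i \<circ> w') t" if "\<forall>x\<in>vars t. i (w' x) = w x" for t
      using that
    proof (induction t)
      case (Var x)
      then show ?case by simp
    next
      case (Op f ts)
      have "map (term_val B w) ts = map (term_val B (i \<circ> w')) ts"
      proof (rule map_cong[OF refl])
        fix u assume u: "u \<in> set ts"
        then have "\<forall>x\<in>vars u. i (w' x) = w x" using Op.prems by auto
        then show "term_val B w u = term_val B (i \<circ> w') u" by (rule Op.IH[OF u])
      qed
      then show ?case by (metis term_val.simps(2))
    qed
    have e': "fst e' \<in> free_terms \<Sigma> UNIV" "snd e' \<in> free_terms \<Sigma> UNIV"
      using laws that by auto
    have "term_val A w' (fst e') = term_val A w' (snd e')"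
      using satA[OF that] w' C_sub by (auto simp: satisfies_def image_subset_iff)
    moreover have "term_val B w (fst e') = i (term_val A w' (fst e'))"
      using cong[of "fst e'"] val[OF e'(1), of w'] w' by auto
    moreover have "term_val B w (snd e') = i (term_val A w' (snd e'))"
      using cong[of "snd e'"] val[OF e'(2), of w'] w' by auto
    ultimately show "term_val B w (fst e') = term_val B w (snd e')" by simp
  qed
  then have "B \<in> variety \<Sigma> E" using algB by (simp add: variety_def)
  then have eB: "satisfies B e" and e: "fst e \<in> free_terms \<Sigma> X" "snd e \<in> free_terms \<Sigma> X"
    using valid by (auto simp: valid_equations_def)
  have "term_val B (i \<circ> v) (fst e) = term_val B (i \<circ> v) (snd e)"
    using eB vC by (auto simp: satisfies_def W_def B_def image_subset_iff)
  moreover have "v ` vars (fst e) \<subseteq> C" "v ` vars (snd e) \<subseteq> C"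
    using vC by (auto simp: W_def)
  ultimately have "i (term_val A v (fst e)) = i (term_val A v (snd e))"
    and "term_val A v (fst e) \<in> C" "term_val A v (snd e) \<in> C"
    using val[OF e(1), of v] val[OF e(2), of v] by auto
  then show "term_val A v (fst e) = term_val A v (snd e)"
    by (metis ji)
qed


section \<open>Presentations and their word problems\<close>

definition is_congruence :: "signature \<Rightarrow> 'x set \<Rightarrow> 'x equation set \<Rightarrow> bool" where
  "is_congruence \<Sigma> X \<theta> \<longleftrightarrow>
     equiv (free_terms \<Sigma> X) \<theta> \<and>
     (\<forall>f\<in>ops \<Sigma>. \<forall>ss ts. length ss = arity \<Sigma> f \<and> list_all2 (\<lambda>s t. (s, t) \<in> \<theta>) ss ts
        \<longrightarrow> (Op f ss, Op f ts) \<in> \<theta>)"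

definition generated_congruence ::
    "signature \<Rightarrow> 'x set \<Rightarrow> 'x equation set \<Rightarrow> 'x equation set" where
  "generated_congruence \<Sigma> X S = \<Inter> {\<theta>. is_congruence \<Sigma> X \<theta> \<and> S \<subseteq> \<theta>}"

definition finite_presentation :: "signature \<Rightarrow> 'x set \<Rightarrow> 'x equation set \<Rightarrow> bool" where
  "finite_presentation \<Sigma> X R \<longleftrightarrow>
     finite X \<and> finite R \<and> R \<subseteq> free_terms \<Sigma> X \<times> free_terms \<Sigma> X"

definition word_congruence ::
    "signature \<Rightarrow> 'a algebra set \<Rightarrow> 'x set \<Rightarrow> 'x equation set \<Rightarrow> 'x equation set" where
  "word_congruence \<Sigma> V X R = generated_congruence \<Sigma> X (R \<union> valid_equations \<Sigma> V X)"


section \<open>Algorithms: partial recursive functions\<close>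

text \<open>\<open>Mu p\<close> is unbounded minimisation; both primitive recursion and minimisation act on the
  first argument.\<close>

datatype recf =
  Zero
| Succ
| Proj nat
| Comp recf "recf list"
| PrimRec recf recf
| Mu recf

text \<open>\<open>computes p xs y\<close>: on the arguments \<open>xs\<close> the program \<open>p\<close> halts with the value \<open>y\<close>.\<close>

inductive computes :: "recf \<Rightarrow> nat list \<Rightarrow> nat \<Rightarrow> bool" where
  Zero: "computes Zero xs 0"
| Succ: "computes Succ [x] (Suc x)"
| Proj: "i < length xs \<Longrightarrow> computes (Proj i) xs (xs ! i)"
| Comp: "\<lbrakk>list_all2 (\<lambda>q y. computes q xs y) qs ys; computes p ys z\<rbrakk> \<Longrightarrow> computes (Comp p qs) xs z"
| PrimRec_0: "computes p xs y \<Longrightarrow> computes (PrimRec p q) (0 # xs) y"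
| PrimRec_Suc: "\<lbrakk>computes (PrimRec p q) (n # xs) r; computes q (n # r # xs) y\<rbrakk>
    \<Longrightarrow> computes (PrimRec p q) (Suc n # xs) y"
| Mu: "\<lbrakk>computes p (n # xs) 0; \<forall>m<n. \<exists>y. computes p (m # xs) (Suc y)\<rbrakk> \<Longrightarrow> computes (Mu p) xs n"

lemma computes_iff:
  "computes Zero xs z \<longleftrightarrow> z = 0"
  "computes Succ xs z \<longleftrightarrow> (\<exists>x. xs = [x] \<and> z = Suc x)"
  "computes (Proj i) xs z \<longleftrightarrow> z = xs ! i \<and> i < length xs"
  "computes (Comp p qs) xs z \<longleftrightarrow>
     (\<exists>ys. list_all2 (\<lambda>q y. computes q xs y) qs ys \<and> computes p ys z)"
  "computes (PrimRec p q) (0 # xs) z \<longleftrightarrow> computes p xs z"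
  "computes (PrimRec p q) (Suc n # xs) z \<longleftrightarrow>
     (\<exists>r. computes (PrimRec p q) (n # xs) r \<and> computes q (n # r # xs) z)"
  "computes (Mu p) xs z \<longleftrightarrow>
     computes p (z # xs) 0 \<and> (\<forall>m<z. \<exists>y. computes p (m # xs) (Suc y))"
  by (subst computes.simps, simp)+

lemma computes_deterministic: "computes p xs y \<Longrightarrow> computes p xs z \<Longrightarrow> y = z"
proof (induction p xs y arbitrary: z rule: computes.induct)
  case (Comp xs qs ys p y)
  have "\<exists>ys'. list_all2 (\<lambda>q y. computes q xs y) qs ys' \<and> computes p ys' z"
    using Comp.prems by (simp only: computes_iff)
  then obtain ys' where ys': "list_all2 (\<lambda>q y. computes q xs y) qs ys'" "computes p ys' z"
    by blast
  have len: "length qs = length ys" "length qs = length ys'"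
    using list_all2_lengthD[OF Comp.IH(1)] list_all2_lengthD[OF ys'(1)] by auto
  have "ys ! k = ys' ! k" if "k < length qs" for k
    using list_all2_nthD[OF Comp.IH(1) that] list_all2_nthD[OF ys'(1) that] by blast
  then have "ys = ys'" using len by (simp add: list_eq_iff_nth_eq)
  then show ?case using Comp.IH(2) ys'(2) by simp
next
  case (PrimRec_Suc p q n xs r y)
  have "\<exists>r'. computes (PrimRec p q) (n # xs) r' \<and> computes q (n # r' # xs) z"
    using PrimRec_Suc.prems by (simp only: computes_iff)
  then show ?case using PrimRec_Suc.IH by blast
next
  case (Mu p n xs)
  have z: "computes p (z # xs) 0" "\<forall>m<z. \<exists>y. computes p (m # xs) (Suc y)"
    using Mu.prems unfolding computes_iff by blast+
  have "\<not> n < z"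
    using z(2) Mu.IH by blast
  moreover have "\<not> z < n"
    using z(1) Mu.hyps Mu.IH by blast
  ultimately show ?case by simp
qed (simp_all only: computes_iff, auto)


definition equation_code :: "nat equation \<Rightarrow> nat" where
  "equation_code e = prod_encode (trm_code (fst e), trm_code (snd e))"

definition recursive_laws :: "nat equation set \<Rightarrow> bool" where
  "recursive_laws E \<longleftrightarrow>
     (\<exists>p. \<forall>s t. computes p [trm_code s, trm_code t] (of_bool ((s, t) \<in> E)))"

text \<open>Generators of a finite presentation are taken to be natural numbers, so that terms and
  presentations can be input to an algorithm. A finite set of natural numbers is
  input as the number whose binary digits are its characteristic function
  (\<^const>\<open>set_encode\<close>).\<close>

definition solvable_word_problem :: "signature \<Rightarrow> nat algebra set \<Rightarrow> bool" where
  "solvable_word_problem \<Sigma> V \<longleftrightarrow>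
     (\<forall>X R. finite_presentation \<Sigma> X R \<longrightarrow>
       (\<exists>p. \<forall>s\<in>free_terms \<Sigma> X. \<forall>t\<in>free_terms \<Sigma> X.
          computes p [trm_code s, trm_code t] (of_bool ((s, t) \<in> word_congruence \<Sigma> V X R))))"

definition uniformly_solvable_word_problem :: "signature \<Rightarrow> nat algebra set \<Rightarrow> bool" where
  "uniformly_solvable_word_problem \<Sigma> V \<longleftrightarrow>
     (\<exists>p. \<forall>X R. finite_presentation \<Sigma> X R \<longrightarrow>
       (\<forall>s\<in>free_terms \<Sigma> X. \<forall>t\<in>free_terms \<Sigma> X.
          computes p [set_encode X, set_encode (equation_code ` R), trm_code s, trm_code t]
            (of_bool ((s, t) \<in> word_congruence \<Sigma> V X R))))"

end

theory Submission
  imports Defs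
begin

text \<open>The language has a constant \<open>0\<close> and unary operations \<open>1\<close>, \<open>2\<close>, \<open>3\<close>. For every \<open>n\<close>, the
  numeral of \<open>n\<close> (\<open>1\<close> applied \<open>n\<close> times to \<open>0\<close>) starts a chain: \<open>2\<close> applied to the numeral, then \<open>3\<close>
  any number of times. The laws say that \<open>0\<close> is a fixed point of \<open>3\<close>, and that the chain of \<open>n\<close> has
  reached \<open>0\<close> after \<open>m + 1\<close> steps if program \<open>n\<close>, run on its own code, has returned \<open>0\<close> within
  \<open>m\<close> steps of a universal machine; this can be decided from \<open>n\<close> and \<open>m\<close>. The single relation that
  stops the chain of \<open>n\<close> at its first term makes this term equal to \<open>0\<close> iff program \<open>n\<close> ever returns
  \<open>0\<close> on its own code, so a uniform algorithm would decide this.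

  For one finite presentation, normal forms are computed from a finite table, which we need not know
  how to find. If two numerals coincide, there are finitely many chains up to congruence, and the
  table contains each of them as far as the place where it reaches \<open>0\<close>, if it does. If all numerals
  are distinct, only finitely many of them are congruent to subterms of the presentation; the table
  takes care of their chains in the same way, and to all the other chains the laws apply as rewrite
  rules.\<close>

section \<open>Computable functions\<close>

named_theorems recursive_intros

text \<open>The function takes the whole argument list, so that closure rules about
  \<open>\<lambda>xs. a xs + b xs\<close> and the like apply by matching alone.\<close>

definition recursive :: "nat \<Rightarrow> (nat list \<Rightarrow> nat) \<Rightarrow> bool" where
  "recursive k f \<longleftrightarrow> (\<exists>p. \<forall>xs. length xs = k \<longrightarrow> computes p xs (f xs))"

lemma recursiveI: "(\<And>xs. length xs = k \<Longrightarrow> computes p xs (f xs)) \<Longrightarrow> recursive k f"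
  by (auto simp: recursive_def)

lemma recursive_zero: "recursive k (\<lambda>xs. 0)"
  by (rule recursiveI) (rule computes.Zero)

lemma recursive_nth [recursive_intros]: "i < k \<Longrightarrow> recursive k (\<lambda>xs. xs ! i)"
  by (rule recursiveI[where p = "Proj i"]) (simp add: computes.Proj)

lemma recursive_comp:
  assumes "recursive (length hs) g" and "\<And>h. h \<in> set hs \<Longrightarrow> recursive k h"
  shows "recursive k (\<lambda>xs. g (map (\<lambda>h. h xs) hs))"
proof -
  obtain p where p: "\<And>xs. length xs = length hs \<Longrightarrow> computes p xs (g xs)"
    using assms(1) by (auto simp: recursive_def)
  obtain q where q: "\<And>h xs. h \<in> set hs \<Longrightarrow> length xs = k \<Longrightarrow> computes (q h) xs (h xs)"
    using assms(2) unfolding recursive_def by metis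
  show ?thesis
  proof (rule recursiveI)
    fix xs :: "nat list" assume "length xs = k"
    then show "computes (Comp p (map q hs)) xs (g (map (\<lambda>h. h xs) hs))"
      by (intro computes.Comp[where ys = "map (\<lambda>h. h xs) hs"] p)
        (auto simp: list_all2_conv_all_nth q)
  qed
qed

lemma recursive_comp1:
  assumes "recursive 1 (\<lambda>xs. f (xs ! 0))" "recursive k a"
  shows "recursive k (\<lambda>xs. f (a xs))"
  using recursive_comp[of "[a]" "\<lambda>xs. f (xs ! 0)" k] assms by simp

lemma recursive_comp2:
  assumes "recursive 2 (\<lambda>xs. f (xs ! 0) (xs ! 1))" "recursive k a" "recursive k b"
  shows "recursive k (\<lambda>xs. f (a xs) (b xs))"
  using recursive_comp[of "[a, b]" "\<lambda>xs. f (xs ! 0) (xs ! 1)" k] assms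
  by (auto simp: numeral_2_eq_2)

lemma recursive_Suc [recursive_intros]:
  assumes "recursive k a"
  shows "recursive k (\<lambda>xs. Suc (a xs))"
proof (rule recursive_comp1[OF recursiveI assms])
  fix xs :: "nat list" assume "length xs = 1"
  then show "computes Succ xs (Suc (xs ! 0))"
    by (cases xs) (auto intro: computes.Succ)
qed

lemma recursive_const [recursive_intros]: "recursive k (\<lambda>xs. c)"
  by (induction c) (auto intro: recursive_zero recursive_Suc)

text \<open>One parameter is enough, since several can be passed as one by pairing.\<close>

lemma recursive_primrec:
  assumes "recursive 1 (\<lambda>xs. b (xs ! 0))"
    and "recursive 3 (\<lambda>xs. s (xs ! 0) (xs ! 1) (xs ! 2))"
  shows "recursive 2 (\<lambda>xs. rec_nat (b (xs ! 1)) (\<lambda>i r. s i r (xs ! 1)) (xs ! 0))"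
proof -
  obtain p where p: "\<And>xs. length xs = 1 \<Longrightarrow> computes p xs (b (xs ! 0))"
    using assms(1) by (auto simp: recursive_def)
  obtain q where q: "\<And>xs. length xs = 3 \<Longrightarrow> computes q xs (s (xs ! 0) (xs ! 1) (xs ! 2))"
    using assms(2) by (auto simp: recursive_def)
  have *: "computes (PrimRec p q) [n, x] (rec_nat (b x) (\<lambda>i r. s i r x) n)" for n x
  proof (induction n)
    case 0
    show ?case using p[of "[x]"] by (auto intro: computes.PrimRec_0)
  next
    case (Suc n)
    show ?case
      using computes.PrimRec_Suc[OF Suc] q[of "[n, rec_nat (b x) (\<lambda>i r. s i r x) n, x]"]
      by simp
  qed
  show ?thesis
  proof (rule recursiveI)
    fix xs :: "nat list" assume "length xs = 2"
    then obtain n x where "xs = [n, x]"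
      by (auto simp: numeral_2_eq_2 length_Suc_conv)
    then show "computes (PrimRec p q) xs
        (rec_nat (b (xs ! 1)) (\<lambda>i r. s i r (xs ! 1)) (xs ! 0))"
      using * by simp
  qed
qed

lemma recursive_rec_nat:
  assumes "recursive 1 (\<lambda>xs. b (xs ! 0))"
    and "recursive 3 (\<lambda>xs. s (xs ! 0) (xs ! 1) (xs ! 2))"
    and "recursive k n" "recursive k x"
  shows "recursive k (\<lambda>xs. rec_nat (b (x xs)) (\<lambda>i r. s i r (x xs)) (n xs))"
  using recursive_comp2[OF recursive_primrec[OF assms(1,2)] assms(3,4)] .

lemma recursive_add [recursive_intros]:
  assumes "recursive k a" "recursive k b"
  shows "recursive k (\<lambda>xs. a xs + b xs)"
proof -
  have "rec_nat y (\<lambda>i r. Suc r) x = x + y" for x y :: nat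
    by (induction x) auto
  moreover have "recursive k (\<lambda>xs. rec_nat (b xs) (\<lambda>i r. Suc r) (a xs))"
    by (rule recursive_rec_nat[where b = "\<lambda>x. x" and s = "\<lambda>i r x. Suc r"])
      ((intro assms recursive_intros | simp)+)
  ultimately show ?thesis by simp
qed

lemma recursive_mult [recursive_intros]:
  assumes "recursive k a" "recursive k b"
  shows "recursive k (\<lambda>xs. a xs * b xs)"
proof -
  have "rec_nat 0 (\<lambda>i r. r + y) x = x * y" for x y :: nat
    by (induction x) auto
  moreover have "recursive k (\<lambda>xs. rec_nat 0 (\<lambda>i r. r + b xs) (a xs))"
    by (rule recursive_rec_nat[where b = "\<lambda>x. 0" and s = "\<lambda>i r x. r + x"])
      ((intro assms recursive_intros | simp)+)
  ultimately show ?thesis by simp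
qed

lemma recursive_pred [recursive_intros]:
  assumes "recursive k a"
  shows "recursive k (\<lambda>xs. a xs - 1)"
proof -
  have "rec_nat 0 (\<lambda>i r. i) x = x - 1" for x :: nat
    by (cases x) auto
  moreover have "recursive k (\<lambda>xs. rec_nat 0 (\<lambda>i r. i) (a xs))"
    by (rule recursive_rec_nat[where b = "\<lambda>x. 0" and s = "\<lambda>i r x. i" and x = a])
      ((intro assms recursive_intros | simp)+)
  ultimately show ?thesis by simp
qed

lemma recursive_diff [recursive_intros]:
  assumes "recursive k a" "recursive k b"
  shows "recursive k (\<lambda>xs. a xs - b xs)"
proof -
  have "rec_nat y (\<lambda>i r. r - 1) x = y - x" for x y :: nat
    by (induction x) auto
  moreover have "recursive k (\<lambda>xs. rec_nat (a xs) (\<lambda>i r. r - 1) (b xs))"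
    by (rule recursive_rec_nat[where b = "\<lambda>x. x" and s = "\<lambda>i r x. r - 1"])
      ((intro assms recursive_intros | simp)+)
  ultimately show ?thesis by simp
qed

lemma recursive_triangle [recursive_intros]:
  assumes "recursive k a"
  shows "recursive k (\<lambda>xs. triangle (a xs))"
proof -
  have "rec_nat 0 (\<lambda>i r. r + Suc i) x = triangle x" for x
    by (induction x) auto
  moreover have "recursive k (\<lambda>xs. rec_nat 0 (\<lambda>i r. r + Suc i) (a xs))"
    by (rule recursive_rec_nat[where b = "\<lambda>x. 0" and s = "\<lambda>i r x. r + Suc i" and x = a])
      ((intro assms recursive_intros | simp)+)
  ultimately show ?thesis by simp
qed

lemma recursive_prod_encode [recursive_intros]:
  assumes "recursive k a" "recursive k b"
  shows "recursive k (\<lambda>xs. prod_encode (a xs, b xs))"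
  unfolding prod_encode_def prod.case
  by (intro assms recursive_intros)

text \<open>The diagonal \<open>m + n\<close> on which \<open>z = prod_encode (m, n)\<close> lies.\<close>

definition diagonal :: "nat \<Rightarrow> nat" where
  "diagonal = rec_nat 0 (\<lambda>i r. r + (1 - (triangle (Suc r) - Suc i)))"

text \<open>The truncated difference in \<open>diagonal\<close> is 1 exactly when
  \<open>Suc z\<close> is the first number of the next diagonal.\<close>

lemma diagonal_bounds: "triangle (diagonal z) \<le> z \<and> z < triangle (Suc (diagonal z))"
proof (induction z)
  case 0
  show ?case by (simp add: diagonal_def)
next
  case (Suc z)
  have "diagonal (Suc z) = diagonal z + (1 - (triangle (Suc (diagonal z)) - Suc z))"
    by (simp add: diagonal_def)
  then show ?case using Suc
    by (cases "triangle (Suc (diagonal z)) = Suc z") auto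
qed

lemma prod_decode_diagonal:
  "prod_decode z = (z - triangle (diagonal z), diagonal z - (z - triangle (diagonal z)))"
proof -
  have "prod_encode (z - triangle (diagonal z), diagonal z - (z - triangle (diagonal z))) = z"
    using diagonal_bounds[of z] by (simp add: prod_encode_def)
  then show ?thesis by (metis prod_encode_inverse)
qed

lemma recursive_diagonal [recursive_intros]:
  assumes "recursive k a"
  shows "recursive k (\<lambda>xs. diagonal (a xs))"
  unfolding diagonal_def
  by (rule recursive_rec_nat[where b = "\<lambda>x. 0" and x = a
        and s = "\<lambda>i r x. r + (1 - (triangle (Suc r) - Suc i))"])
    ((intro assms recursive_intros | simp)+)

lemma recursive_fst_prod_decode [recursive_intros]:
  "recursive k a \<Longrightarrow> recursive k (\<lambda>xs. fst (prod_decode (a xs)))"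
  unfolding prod_decode_diagonal fst_conv
  by (intro recursive_intros)

lemma recursive_snd_prod_decode [recursive_intros]:
  "recursive k a \<Longrightarrow> recursive k (\<lambda>xs. snd (prod_decode (a xs)))"
  unfolding prod_decode_diagonal snd_conv
  by (intro recursive_intros)

lemma recursive_if_zero [recursive_intros]:
  assumes "recursive k c" "recursive k a" "recursive k b"
  shows "recursive k (\<lambda>xs. if c xs = 0 then a xs else b xs)"
proof -
  \<comment> \<open>With truncated subtraction \<open>1 - c\<close> indicates \<open>c = 0\<close>
    and \<open>1 - (1 - c)\<close> the opposite, so the products select the branch.\<close>
  have "(\<lambda>xs. if c xs = 0 then a xs else b xs)
      = (\<lambda>xs. a xs * (1 - c xs) + b xs * (1 - (1 - c xs)))"
    by auto
  then show ?thesis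
    by (simp only:) (intro assms recursive_intros)
qed

section \<open>Computability between types with injective codes\<close>

class encodable =
  fixes encode :: "'a \<Rightarrow> nat"
  assumes inj_encode: "inj encode"

lemma encode_eq_iff: "encode x = encode y \<longleftrightarrow> x = y"
  using inj_encode by (auto simp: inj_def)

instantiation nat :: encodable
begin
definition encode_nat :: "nat \<Rightarrow> nat" where "encode_nat n = n"
instance by standard (simp add: encode_nat_def inj_def)
end

instantiation bool :: encodable
begin
definition encode_bool :: "bool \<Rightarrow> nat" where "encode_bool = of_bool"
instance by standard (simp add: encode_bool_def inj_def)
end

instantiation prod :: (encodable, encodable) encodable
begin
definition encode_prod :: "'a \<times> 'b \<Rightarrow> nat" where
  "encode_prod x = prod_encode (encode (fst x), encode (snd x))"
instance
  by standard (auto simp: encode_prod_def inj_def prod_eq_iff encode_eq_iff)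
end

instantiation list :: (encodable) encodable
begin
definition encode_list :: "'a list \<Rightarrow> nat" where
  "encode_list xs = list_encode (map encode xs)"
instance
  by standard (auto simp: encode_list_def inj_def list_encode_eq encode_eq_iff
      dest: map_inj_on[of encode] intro: inj_onI map_injective[OF _ inj_encode])
end

text \<open>Tuples and lists enter as a single number, and \<open>g\<close> is arbitrary on numbers
  that code nothing. Machine states, words and booleans are thus covered by one unary
  notion.\<close>

definition computable :: "('a::encodable \<Rightarrow> 'b::encodable) \<Rightarrow> bool" where
  "computable f \<longleftrightarrow> (\<exists>g. recursive 1 (\<lambda>xs. g (xs ! 0)) \<and> (\<forall>x. g (encode x) = encode (f x)))"

lemma computableI:
  "recursive 1 (\<lambda>xs. g (xs ! 0)) \<Longrightarrow> (\<And>x. g (encode x) = encode (f x)) \<Longrightarrow> computable f"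
  by (auto simp: computable_def)

named_theorems computable_intros

lemma computable_id [computable_intros]: "computable (\<lambda>x. x)"
  by (rule computableI[where g = "\<lambda>x. x"]) ((intro recursive_intros | simp)+)

lemma computable_const [computable_intros]: "computable (\<lambda>x. c)"
  by (rule computableI[where g = "\<lambda>x. encode c"]) ((intro recursive_intros | simp)+)

lemma computable_compose:
  assumes "computable f" "computable g"
  shows "computable (\<lambda>x. f (g x))"
proof -
  obtain f' where f': "recursive 1 (\<lambda>xs. f' (xs ! 0))" "\<And>x. f' (encode x) = encode (f x)"
    using assms(1) by (auto simp: computable_def)
  obtain g' where g': "recursive 1 (\<lambda>xs. g' (xs ! 0))" "\<And>x. g' (encode x) = encode (g x)"
    using assms(2) by (auto simp: computable_def)
  show ?thesis
    by (rule computableI[where g = "\<lambda>x. f' (g' x)"])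
      (use recursive_comp1[OF f'(1) g'(1)] f'(2) g'(2) in auto)
qed

lemma computable_pair [computable_intros]:
  assumes "computable f" "computable g"
  shows "computable (\<lambda>x. (f x, g x))"
proof -
  obtain f' where f': "recursive 1 (\<lambda>xs. f' (xs ! 0))" "\<And>x. f' (encode x) = encode (f x)"
    using assms(1) by (auto simp: computable_def)
  obtain g' where g': "recursive 1 (\<lambda>xs. g' (xs ! 0))" "\<And>x. g' (encode x) = encode (g x)"
    using assms(2) by (auto simp: computable_def)
  show ?thesis
    by (rule computableI[where g = "\<lambda>x. prod_encode (f' x, g' x)"])
      ((intro recursive_intros f'(1) g'(1) | simp add: f'(2) g'(2) encode_prod_def)+)
qed

lemma computable_fst_aux: "computable fst"
  by (rule computableI[where g = "\<lambda>x. fst (prod_decode x)"])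
    ((intro recursive_intros | simp add: encode_prod_def)+)

lemmas computable_fst [computable_intros] = computable_compose[OF computable_fst_aux]

lemma computable_snd_aux: "computable snd"
  by (rule computableI[where g = "\<lambda>x. snd (prod_decode x)"])
    ((intro recursive_intros | simp add: encode_prod_def)+)

lemmas computable_snd [computable_intros] = computable_compose[OF computable_snd_aux]

lemma computable_case_prod [computable_intros]:
  assumes "computable (\<lambda>x. f x (fst (p x)) (snd (p x)))"
  shows "computable (\<lambda>x. case p x of (a, b) \<Rightarrow> f x a b)"
  using assms by (simp add: case_prod_beta)

lemma computable_uncurry:
  assumes "computable (\<lambda>x. f (fst x) (snd x))" "computable a" "computable b"
  shows "computable (\<lambda>x. f (a x) (b x))"
  using computable_compose[OF assms(1) computable_pair[OF assms(2,3)]] by simp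

lemma computable_nat_binop:
  fixes a b :: "'a::encodable \<Rightarrow> nat" and f :: "nat \<Rightarrow> nat \<Rightarrow> nat"
  assumes "\<And>g h. recursive 1 g \<Longrightarrow> recursive 1 h \<Longrightarrow> recursive 1 (\<lambda>xs. f (g xs) (h xs))"
    and "computable a" "computable b"
  shows "computable (\<lambda>x. f (a x) (b x))"
proof (rule computable_uncurry[OF _ assms(2,3)])
  show "computable (\<lambda>x. f (fst x) (snd x))"
    by (rule computableI[where g = "\<lambda>x. f (fst (prod_decode x)) (snd (prod_decode x))"])
      ((intro assms(1) recursive_intros | simp add: encode_prod_def encode_nat_def)+)
qed

lemma computable_Suc [computable_intros]:
  assumes "computable a"
  shows "computable (\<lambda>x. Suc (a x))"
  by (rule computable_compose[OF computableI[where g = Suc] assms])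
    ((intro recursive_intros | simp add: encode_nat_def)+)

lemma computable_plus [computable_intros]:
  "computable a \<Longrightarrow> computable b \<Longrightarrow> computable (\<lambda>x. a x + b x :: nat)"
  by (rule computable_nat_binop[OF recursive_add])

lemma computable_times [computable_intros]:
  "computable a \<Longrightarrow> computable b \<Longrightarrow> computable (\<lambda>x. a x * b x :: nat)"
  by (rule computable_nat_binop[OF recursive_mult])

lemma computable_minus [computable_intros]:
  "computable a \<Longrightarrow> computable b \<Longrightarrow> computable (\<lambda>x. a x - b x :: nat)"
  by (rule computable_nat_binop[OF recursive_diff])

text \<open>On codes this is the identity, as \<open>prod_encode\<close> is itself the code of a
  pair of numbers; the same is true of decoding, of the list versions and of
  \<open>of_bool\<close>.\<close>

lemma computable_prod_encode [computable_intros]: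
  assumes "computable a"
  shows "computable (\<lambda>x. prod_encode (a x))"
  by (rule computable_compose[OF computableI[where g = "\<lambda>x. x"] assms])
    ((intro recursive_intros | simp add: encode_prod_def encode_nat_def)+)

lemma computable_prod_decode [computable_intros]:
  assumes "computable a"
  shows "computable (\<lambda>x. prod_decode (a x))"
  by (rule computable_compose[OF computableI[where g = "\<lambda>x. x"] assms])
    ((intro recursive_intros | simp add: encode_prod_def encode_nat_def)+)

lemma map_encode_nat: "map encode xs = (xs :: nat list)"
  by (simp add: encode_nat_def map_idI)

lemma computable_list_encode [computable_intros]:
  assumes "computable a"
  shows "computable (\<lambda>x. list_encode (a x))"
  by (rule computable_compose[OF computableI[where g = "\<lambda>x. x"] assms])
    ((intro recursive_intros | simp add: encode_list_def map_encode_nat encode_nat_def)+)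

lemma computable_list_decode [computable_intros]:
  assumes "computable a"
  shows "computable (\<lambda>x. list_decode (a x))"
  by (rule computable_compose[OF computableI[where g = "\<lambda>x. x"] assms])
    ((intro recursive_intros | simp add: encode_list_def map_encode_nat encode_nat_def)+)

lemma computable_of_bool [computable_intros]:
  assumes "computable a"
  shows "computable (\<lambda>x. of_bool (a x) :: nat)"
  by (rule computable_compose[OF computableI[where g = "\<lambda>x. x"] assms])
    ((intro recursive_intros | simp add: encode_bool_def encode_nat_def)+)

lemma computable_if [computable_intros]:
  assumes "computable c" "computable f" "computable g"
  shows "computable (\<lambda>x. if c x then f x else g x)"
proof -
  obtain c' where c': "recursive 1 (\<lambda>xs. c' (xs ! 0))" "\<And>x. c' (encode x) = encode (c x)"
    using assms(1) by (auto simp: computable_def)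
  obtain f' where f': "recursive 1 (\<lambda>xs. f' (xs ! 0))" "\<And>x. f' (encode x) = encode (f x)"
    using assms(2) by (auto simp: computable_def)
  obtain g' where g': "recursive 1 (\<lambda>xs. g' (xs ! 0))" "\<And>x. g' (encode x) = encode (g x)"
    using assms(3) by (auto simp: computable_def)
  show ?thesis
    by (rule computableI[where g = "\<lambda>x. if c' x = 0 then g' x else f' x"])
      ((intro recursive_intros c'(1) f'(1) g'(1) | simp add: c'(2) f'(2) g'(2) encode_bool_def)+)
qed

lemma computable_not [computable_intros]:
  assumes "computable a"
  shows "computable (\<lambda>x. \<not> a x)"
proof -
  have "(\<lambda>x. \<not> a x) = (\<lambda>x. if a x then False else True)" by auto
  then show ?thesis by (simp only:) (intro computable_intros assms)
qed

lemma computable_conj [computable_intros]: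
  assumes "computable a" "computable b"
  shows "computable (\<lambda>x. a x \<and> b x)"
proof -
  have "(\<lambda>x. a x \<and> b x) = (\<lambda>x. if a x then b x else False)" by auto
  then show ?thesis by (simp only:) (intro computable_intros assms)
qed

lemma computable_disj [computable_intros]:
  assumes "computable a" "computable b"
  shows "computable (\<lambda>x. a x \<or> b x)"
proof -
  have "(\<lambda>x. a x \<or> b x) = (\<lambda>x. if a x then True else b x)" by auto
  then show ?thesis by (simp only:) (intro computable_intros assms)
qed

lemma computable_encode [computable_intros]:
  assumes "computable a"
  shows "computable (\<lambda>x. encode (a x))"
  by (rule computable_compose[OF computableI[where g = "\<lambda>x. x"] assms])
    ((intro recursive_intros | simp add: encode_nat_def)+)

lemma computable_eq_zero:
  assumes "computable (a :: 'a::encodable \<Rightarrow> nat)"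
  shows "computable (\<lambda>x. a x = 0)"
  by (rule computable_compose[OF computableI[where g = "\<lambda>x. 1 - x"] assms])
    ((intro recursive_intros | simp add: encode_nat_def encode_bool_def)+)

lemma computable_le [computable_intros]:
  assumes "computable a" "computable b"
  shows "computable (\<lambda>x. a x \<le> (b x :: nat))"
  using computable_eq_zero[OF computable_minus[OF assms]] by simp

text \<open>Injectivity of the codes reduces equality in any type to two comparisons of
  numbers.\<close>

lemma computable_eq [computable_intros]:
  assumes "computable a" "computable b"
  shows "computable (\<lambda>x. a x = b x)"
proof -
  have "computable (\<lambda>x. encode (a x) \<le> encode (b x) \<and> encode (b x) \<le> encode (a x))"
    by (intro computable_intros assms)
  moreover have "encode (a x) \<le> encode (b x) \<and> encode (b x) \<le> encode (a x) \<longleftrightarrow> a x = b x" for x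
    by (metis encode_eq_iff order_antisym order_refl)
  ultimately show ?thesis by simp
qed

text \<open>The numeric recursion runs on codes of the intermediate results, with the code of the
  whole input as its one parameter.\<close>

lemma computable_rec_nat [computable_intros]:
  fixes b :: "'a::encodable \<Rightarrow> 'b::encodable" and n :: "'a \<Rightarrow> nat"
  assumes "computable b" "computable n"
    and "computable (\<lambda>z. s (fst z) (fst (snd z)) (snd (snd z)))"
  shows "computable (\<lambda>x. rec_nat (b x) (s x) (n x))"
proof -
  obtain b' where b': "recursive 1 (\<lambda>xs. b' (xs ! 0))" "\<And>x. b' (encode x) = encode (b x)"
    using assms(1) by (auto simp: computable_def)
  obtain n' where n': "recursive 1 (\<lambda>xs. n' (xs ! 0))" "\<And>x. n' (encode x) = n x"
    using assms(2) by (auto simp: computable_def encode_nat_def)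
  obtain s' where s': "recursive 1 (\<lambda>xs. s' (xs ! 0))"
    "\<And>x i r. s' (encode (x, i, r)) = encode (s x i r)"
    using assms(3) by (auto simp: computable_def)
  let ?g = "\<lambda>x. rec_nat (b' x) (\<lambda>i r. s' (prod_encode (x, prod_encode (i, r)))) (n' x)"
  show ?thesis
  proof (rule computableI[where g = ?g])
    show "recursive 1 (\<lambda>xs. ?g (xs ! 0))"
      by (rule recursive_rec_nat[where b = b' and x = "\<lambda>xs. xs ! 0" and n = "\<lambda>xs. n' (xs ! 0)"
            and s = "\<lambda>i r x. s' (prod_encode (x, prod_encode (i, r)))"])
        ((intro b'(1) n'(1) recursive_comp1[OF s'(1)] recursive_intros | simp)+)
    fix x :: 'a
    have "rec_nat (b' (encode x)) (\<lambda>i r. s' (prod_encode (encode x, prod_encode (i, r)))) m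
        = encode (rec_nat (b x) (s x) m)" for m
      by (induction m) (auto simp: b' s'(2)[symmetric] encode_prod_def encode_nat_def)
    then show "?g (encode x) = encode (rec_nat (b x) (s x) (n x))"
      by (simp add: n')
  qed
qed

lemma computable_funpow [computable_intros]:
  fixes f :: "'a::encodable \<Rightarrow> 'b::encodable \<Rightarrow> 'b"
  assumes "computable (\<lambda>z. f (fst z) (snd z))" "computable n" "computable a"
  shows "computable (\<lambda>x. (f x ^^ n x) (a x))"
proof -
  have "(g ^^ m) y = rec_nat y (\<lambda>i r. g r) m" for g :: "'b \<Rightarrow> 'b" and m y
    by (induction m) auto
  moreover have "computable (\<lambda>x. rec_nat (a x) (\<lambda>i r. f x r) (n x))"
    by (intro computable_rec_nat assms computable_uncurry[where f = f, OF assms(1)] computable_intros)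
  ultimately show ?thesis by simp
qed

lemma computable_power [computable_intros]:
  assumes "computable a" "computable n"
  shows "computable (\<lambda>x. (a x :: nat) ^ n x)"
proof -
  have "(a :: nat) ^ m = ((\<lambda>r. a * r) ^^ m) 1" for a m
    by (induction m) auto
  moreover have "computable (\<lambda>x. ((\<lambda>r. a x * r) ^^ n x) 1)"
    by (intro computable_intros computable_compose[OF assms(1)] assms)
  ultimately show ?thesis by simp
qed

lemma computable_Ex_less [computable_intros]:
  fixes b :: "'a::encodable \<Rightarrow> nat"
  assumes "computable (\<lambda>z. P (fst z) (snd z))" "computable b"
  shows "computable (\<lambda>x. \<exists>i<b x. P x i)"
proof -
  have "(\<exists>i<m. Q i) = rec_nat False (\<lambda>i r. r \<or> Q i) m" for Q and m :: nat
    by (induction m) (auto simp: less_Suc_eq)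
  moreover have "computable (\<lambda>x. rec_nat False (\<lambda>i r. r \<or> P x i) (b x))"
    by (intro computable_rec_nat assms computable_uncurry[where f = P, OF assms(1)] computable_intros)
  ultimately show ?thesis by simp
qed

lemma computable_div2 [computable_intros]:
  assumes "computable a"
  shows "computable (\<lambda>x. a x div 2 :: nat)"
proof -
  \<comment> \<open>The state counts the steps made: the first component is the parity, the second
    is half the number, rounded down.\<close>
  define s where "s = (\<lambda>z :: bool \<times> nat. (\<not> fst z, if fst z then Suc (snd z) else snd z))"
  have "(s ^^ m) (False, 0) = (odd m, m div 2)" for m
    by (induction m) (auto simp: s_def)
  moreover have "computable (\<lambda>x. snd ((s ^^ a x) (False, 0)))"
    unfolding s_def by (intro computable_intros assms)
  ultimately show ?thesis by simp
qed

text \<open>The code of a nonempty list is the successor of the code of the pair of head and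
  tail.\<close>

lemma computable_Cons [computable_intros]:
  assumes "computable a" "computable l"
  shows "computable (\<lambda>x. a x # l x)"
proof -
  have "computable (\<lambda>z :: 'b \<times> 'b list. fst z # snd z)"
    by (rule computableI[where g = Suc])
      ((intro recursive_intros | simp add: encode_prod_def encode_list_def)+)
  from computable_uncurry[OF this assms] show ?thesis .
qed

lemma computable_case_list [computable_intros]:
  fixes l :: "'a::encodable \<Rightarrow> 'b::encodable list"
  assumes "computable l" "computable f"
    and "computable (\<lambda>z. g (fst z) (fst (snd z)) (snd (snd z)))"
  shows "computable (\<lambda>x. case l x of [] \<Rightarrow> f x | y # ys \<Rightarrow> g x y ys)"
proof -
  obtain l' where l': "recursive 1 (\<lambda>xs. l' (xs ! 0))" "\<And>x. l' (encode x) = encode (l x)"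
    using assms(1) by (auto simp: computable_def)
  obtain f' where f': "recursive 1 (\<lambda>xs. f' (xs ! 0))" "\<And>x. f' (encode x) = encode (f x)"
    using assms(2) by (auto simp: computable_def)
  obtain g' where g': "recursive 1 (\<lambda>xs. g' (xs ! 0))"
    "\<And>x y ys. g' (encode (x, y, ys)) = encode (g x y ys)"
    using assms(3) by (auto simp: computable_def)
  show ?thesis
    by (rule computableI[where g = "\<lambda>x. if l' x = 0 then f' x else g' (prod_encode (x, l' x - 1))"])
      ((intro recursive_intros l'(1) f'(1) recursive_comp1[OF g'(1)]
        | simp add: l'(2) f'(2) g'(2)[symmetric] encode_prod_def encode_list_def split: list.split)+)
qed

lemma computable_hd [computable_intros]:
  assumes "computable l"
  shows "computable (\<lambda>x. hd (l x))"
proof -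
  have "(\<lambda>x. hd (l x)) = (\<lambda>x. case l x of [] \<Rightarrow> hd [] | y # ys \<Rightarrow> y)"
    by (auto simp: fun_eq_iff split: list.split)
  then show ?thesis by (simp only:) (intro computable_intros assms)
qed

lemma computable_tl [computable_intros]:
  assumes "computable l"
  shows "computable (\<lambda>x. tl (l x))"
  unfolding tl_def by (intro computable_intros assms)

lemma computable_drop [computable_intros]:
  assumes "computable n" "computable l"
  shows "computable (\<lambda>x. drop (n x) (l x))"
proof -
  have "drop m ys = (tl ^^ m) ys" for m and ys :: "'b list"
    by (induction m arbitrary: ys) (auto simp: drop_Suc funpow_swap1)
  then show ?thesis by (simp only:) (intro computable_intros assms)
qed

text \<open>The values of \<open>f\<close> on \<open>F\<close> become constants of the program, so
  \<open>f\<close> may be any function. This is why a finite table can be used without a method for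
  finding it.\<close>

lemma computable_finite_update:
  fixes f g :: "'a::encodable \<Rightarrow> 'b::encodable"
  assumes "finite F" "computable g"
  shows "computable (\<lambda>x. if x \<in> F then f x else g x)"
  using assms(1)
proof (induction F)
  case empty
  then show ?case using assms(2) by simp
next
  case (insert y F)
  have "(\<lambda>x. if x \<in> insert y F then f x else g x)
      = (\<lambda>x. if x = y then f y else if x \<in> F then f x else g x)"
    by auto
  then show ?case by (simp only:) (intro computable_intros insert.IH)
qed

section \<open>From computable functions back to programs\<close>

lemma computes_of_computable1:
  fixes f :: "nat \<Rightarrow> nat"
  assumes "computable f"
  obtains p where "\<And>x. computes p [x] (f x)"
proof -
  obtain g where g: "recursive 1 (\<lambda>xs. g (xs ! 0))" "\<And>x. g x = f x"
    using assms by (auto simp: computable_def encode_nat_def)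
  then obtain p where p: "\<And>xs. length xs = 1 \<Longrightarrow> computes p xs (g (xs ! 0))"
    by (auto simp: recursive_def)
  show thesis by (rule that[of p]) (use p[of "[_]"] g(2) in simp)
qed

lemma computes_of_computable2:
  fixes f :: "nat \<Rightarrow> nat \<Rightarrow> nat"
  assumes "computable (\<lambda>z. f (fst z) (snd z))"
  obtains p where "\<And>x y. computes p [x, y] (f x y)"
proof -
  obtain g where g: "recursive 1 (\<lambda>xs. g (xs ! 0))" "\<And>x y. g (prod_encode (x, y)) = f x y"
    using assms by (auto simp: computable_def encode_nat_def encode_prod_def)
  have "recursive 2 (\<lambda>xs. g (prod_encode (xs ! 0, xs ! 1)))"
    by (rule recursive_comp1[OF g(1)]) ((intro recursive_intros | simp)+)
  then obtain p where p: "\<And>xs. length xs = 2 \<Longrightarrow> computes p xs (f (xs ! 0) (xs ! 1))"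
    using g(2) by (auto simp: recursive_def)
  show thesis by (rule that[of p]) (use p[of "[_, _]"] in simp)
qed

section \<open>A universal machine\<close>

text \<open>Programs are coded so that a machine can run them. The arguments of a composition are stored
  in reverse, because the machine accumulates their values by prepending.\<close>

fun program_code :: "recf \<Rightarrow> nat" where
  "program_code Zero = prod_encode (1, 0)"
| "program_code Succ = prod_encode (2, 0)"
| "program_code (Proj i) = prod_encode (3, i)"
| "program_code (Comp p qs) =
     prod_encode (4, prod_encode (program_code p, list_encode (rev (map program_code qs))))"
| "program_code (PrimRec p q) = prod_encode (5, prod_encode (program_code p, program_code q))"
| "program_code (Mu p) = prod_encode (6, program_code p)"

text \<open>A state \<open>(c, xs, frames)\<close> is about to run the program with code \<open>c\<close> on \<open>xs\<close>; the code \<open>0\<close>,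
  which is not the code of a program, means that the value \<open>hd xs\<close> is returned to the topmost frame.
  The first component of a frame tells whether it belongs to a composition, a primitive recursion
  or a minimisation.\<close>

type_synonym frame = "nat \<times> nat \<times> nat list \<times> nat list \<times> nat list"
type_synonym state = "nat \<times> nat list \<times> frame list"

definition compose_args ::
    "nat \<Rightarrow> nat list \<Rightarrow> nat list \<Rightarrow> nat list \<Rightarrow> frame list \<Rightarrow> state" where
  "compose_args p qs xs ys K =
     (case qs of [] \<Rightarrow> (p, ys, K) | q # qs' \<Rightarrow> (q, xs, (0, p, qs', xs, ys) # K))"

text \<open>The field \<open>l\<close> holds the arguments still to be run for a composition, the
  counter for a recursion and the current candidate for a minimisation.\<close>

definition resume :: "nat \<Rightarrow> frame \<Rightarrow> frame list \<Rightarrow> state" where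
  "resume v = (\<lambda>(t, p, l, xs, ys) K.
     if t = 0 then compose_args p l xs (v # ys) K
     else if t = 1 then (p, hd l # v # xs, K)
     else if v = 0 then (0, [hd l], K)
     else (p, Suc (hd l) # xs, (2, p, [Suc (hd l)], xs, []) # K))"

text \<open>Returning with no frame left is a fixed point, so a result can be read off at any later
  time.\<close>

definition step :: "state \<Rightarrow> state" where
  "step = (\<lambda>(c, xs, K). case prod_decode c of (t, a) \<Rightarrow>
     if t = 0 then (case K of [] \<Rightarrow> (c, xs, K) | F # K' \<Rightarrow> resume (hd xs) F K')
     else if t = 1 then (0, [0], K)
     else if t = 2 then (0, [Suc (hd xs)], K)
     else if t = 3 then (0, [hd (drop a xs)], K)
     else if t = 4 then
       (case prod_decode a of (p, qs) \<Rightarrow> compose_args p (list_decode qs) xs [] K)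
     else if t = 5 then
       (case prod_decode a of (p, q) \<Rightarrow>
          if hd xs = 0 then (p, tl xs, K)
          else (c, (hd xs - 1) # tl xs, (1, q, [hd xs - 1], tl xs, []) # K))
     else (a, 0 # xs, (2, a, [0], xs, []) # K))"

lemma computable_step: "computable step"
  unfolding step_def resume_def compose_args_def case_prod_beta
  by (intro computable_intros)

definition reaches :: "state \<Rightarrow> state \<Rightarrow> bool" where
  "reaches s t \<longleftrightarrow> (\<exists>m. (step ^^ m) s = t)"

lemma reaches_refl: "reaches s s"
  unfolding reaches_def by (rule exI[of _ 0]) simp

lemma reaches_step: "reaches (step s) t \<Longrightarrow> reaches s t"
  unfolding reaches_def by (metis funpow_Suc_right o_apply)

lemma reaches_trans: "reaches s t \<Longrightarrow> reaches t u \<Longrightarrow> reaches s u"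
  unfolding reaches_def by (metis funpow_add o_apply)

lemma prod_decode_0: "prod_decode 0 = (0, 0)"
  using prod_encode_inverse[of "(0, 0)"] by (simp add: prod_encode_def)

lemma step_return: "step (0, [v], F # K) = resume v F K"
  by (simp add: step_def prod_decode_0)

text \<open>Induction from the end of \<open>qs\<close>, because the last argument is evaluated
  first; \<open>ys\<close> holds the values already collected.\<close>

lemma reaches_compose_args:
  assumes "list_all2 (\<lambda>q y. \<forall>K. reaches (program_code q, xs, K) (0, [y], K)) qs vs"
  shows "reaches (compose_args p (rev (map program_code qs)) xs ys K) (p, vs @ ys, K)"
  using assms
proof (induction qs arbitrary: vs ys rule: rev_induct)
  case Nil
  then show ?case by (simp add: compose_args_def reaches_refl)
next
  case (snoc q qs)
  then obtain vs' v where vs: "vs = vs' @ [v]"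
    and v: "\<And>K. reaches (program_code q, xs, K) (0, [v], K)"
    and vs': "list_all2 (\<lambda>q y. \<forall>K. reaches (program_code q, xs, K) (0, [y], K)) qs vs'"
    by (auto simp: list_all2_append1 list_all2_Cons1)
  let ?F = "(0, p, rev (map program_code qs), xs, ys)"
  have "compose_args p (rev (map program_code (qs @ [q]))) xs ys K
      = (program_code q, xs, ?F # K)"
    by (simp add: compose_args_def)
  moreover have "step (0, [v], ?F # K) = compose_args p (rev (map program_code qs)) xs (v # ys) K"
    by (simp add: step_return resume_def)
  ultimately show ?case
    using snoc.IH[OF vs', of "v # ys"] vs
    by (auto intro!: reaches_trans[OF v] intro: reaches_step)
qed

text \<open>Downward induction from \<open>n\<close>: a nonzero value moves the search from
  \<open>m\<close> to \<open>Suc m\<close>, and the value 0 at \<open>n\<close> ends it.\<close>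

lemma reaches_Mu:
  assumes "\<And>K. reaches (c, n # xs, K) (0, [0], K)"
    and "\<And>m. m < n \<Longrightarrow> \<exists>y. \<forall>K. reaches (c, m # xs, K) (0, [Suc y], K)"
    and "m \<le> n"
  shows "reaches (c, m # xs, (2, c, [m], xs, []) # K) (0, [n], K)"
  using assms(3)
proof (induction m rule: inc_induct)
  case base
  have "step (0, [0], (2, c, [n], xs, []) # K) = (0, [n], K)"
    by (simp add: step_return resume_def)
  then show ?case
    by - (rule reaches_trans[OF assms(1)], rule reaches_step, simp add: reaches_refl)
next
  case (step m)
  obtain y where y: "\<And>K. reaches (c, m # xs, K) (0, [Suc y], K)"
    using assms(2) step.hyps by blast
  have "step (0, [Suc y], (2, c, [m], xs, []) # K) = (c, Suc m # xs, (2, c, [Suc m], xs, []) # K)"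
    by (simp add: step_return resume_def)
  then show ?case
    by - (rule reaches_trans[OF y], rule reaches_step, simp add: step.IH)
qed

text \<open>Induction on the computation, for every stack \<open>K\<close>, because subprograms run
  on top of the frames of their callers.\<close>

lemma reaches_of_computes: "computes p xs y \<Longrightarrow> reaches (program_code p, xs, K) (0, [y], K)"
proof (induction p xs y arbitrary: K rule: computes.induct)
  case (Zero xs)
  show ?case by (rule reaches_step) (simp add: step_def reaches_refl)
next
  case (Succ x)
  show ?case by (rule reaches_step) (simp add: step_def reaches_refl)
next
  case (Proj i xs)
  then show ?case by - (rule reaches_step, simp add: step_def hd_drop_conv_nth reaches_refl)
next
  case (Comp xs qs ys p z)
  have "list_all2 (\<lambda>q y. \<forall>K. reaches (program_code q, xs, K) (0, [y], K)) qs ys"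
    using Comp.IH(1) by (rule list_all2_mono) auto
  from reaches_compose_args[OF this, of "program_code p" "[]" K] Comp.IH(2) show ?case
    by - (rule reaches_step, auto simp: step_def intro: reaches_trans)
next
  case (PrimRec_0 p xs y q)
  then show ?case by - (rule reaches_step, simp add: step_def)
next
  case (PrimRec_Suc p q n xs r y)
  let ?K = "(1, program_code q, [n], xs, []) # K"
  have "reaches (program_code (PrimRec p q), n # xs, ?K) (0, [r], ?K)"
    by (rule PrimRec_Suc.IH)
  moreover have "step (0, [r], ?K) = (program_code q, n # r # xs, K)"
    by (simp add: step_return resume_def)
  ultimately have "reaches (program_code (PrimRec p q), n # xs, ?K) (0, [y], K)"
    using PrimRec_Suc.IH(2)[of K] by (elim reaches_trans) (simp add: reaches_step)
  then show ?case by - (rule reaches_step, simp add: step_def)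
next
  case (Mu p n xs)
  have "reaches (program_code p, 0 # xs, (2, program_code p, [0], xs, []) # K) (0, [n], K)"
    by (rule reaches_Mu) (use Mu.IH in blast)+
  then show ?case by - (rule reaches_step, simp add: step_def)
qed

text \<open>The state reached is a fixed point of \<open>step\<close>, so for given \<open>n\<close>
  this holds either from some \<open>m\<close> on or for no \<open>m\<close>.\<close>

definition halts0 :: "nat \<Rightarrow> nat \<Rightarrow> bool" where
  "halts0 n m \<longleftrightarrow> (step ^^ m) (n, [n], []) = (0, [0], [])"

lemma computable_halts0 [computable_intros]:
  assumes "computable n" "computable m"
  shows "computable (\<lambda>x. halts0 (n x) (m x))"
  unfolding halts0_def
  by (intro computable_compose[OF computable_step] computable_intros assms)

lemma step_funpow_return: "(step ^^ m) (0, [v], []) = (0, [v], [])"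
  by (induction m) (auto simp: step_def prod_decode_0)

text \<open>Diagonal argument: on its own code such a program would return 1 if it returns 0, and 0
  if it does not.\<close>

lemma not_computes_halts0: "\<not> (\<forall>n. computes p [n] (of_bool (\<exists>m. halts0 n m)))"
proof
  assume p: "\<forall>n. computes p [n] (of_bool (\<exists>m. halts0 n m))"
  define n where "n = program_code p"
  have "reaches (n, [n], []) (0, [of_bool (\<exists>m. halts0 n m)], [])"
    unfolding n_def using p by (intro reaches_of_computes) blast
  then obtain m where m: "(step ^^ m) (n, [n], []) = (0, [of_bool (\<exists>m. halts0 n m)], [])"
    by (auto simp: reaches_def)
  show False
  proof (cases "\<exists>m. halts0 n m")
    case True
    then obtain m' where m': "(step ^^ m') (n, [n], []) = (0, [0], [])"
      by (auto simp: halts0_def)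
    \<comment> \<open>Both runs are prolonged to the same length, where they would have to
      agree.\<close>
    have "(step ^^ (m + m')) (n, [n], []) = (0, [0], [])"
      using m' by (simp add: funpow_add step_funpow_return)
    moreover have "(step ^^ (m' + m)) (n, [n], []) = (0, [1], [])"
      using m True by (simp add: funpow_add step_funpow_return)
    ultimately show False by (simp add: add.commute)
  next
    case False
    then show False using m by (auto simp: halts0_def)
  qed
qed

section \<open>The variety and its presentations\<close>

lemma free_terms_mono: "t \<in> free_terms \<Sigma> X \<Longrightarrow> X \<subseteq> Y \<Longrightarrow> t \<in> free_terms \<Sigma> Y"
  by (induction t rule: free_terms.induct) (auto intro: free_terms.intros)

lemma term_val_closed:
  assumes "t \<in> free_terms \<Sigma> {}"
  shows "term_val A v t = term_val A w t"
  using assms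
proof (induction t rule: free_terms.induct)
  case (Op f ts)
  then have "map (term_val A v) ts = map (term_val A w) ts" by auto
  then show ?case by (metis term_val.simps(2))
qed simp

text \<open>The full relation is a congruence containing \<open>S\<close>, so the intersected family
  is nonempty; the closure properties pass to intersections.\<close>

lemma generated_congruence_is_congruence:
  assumes "S \<subseteq> free_terms \<Sigma> X \<times> free_terms \<Sigma> X"
  shows "is_congruence \<Sigma> X (generated_congruence \<Sigma> X S)"
proof -
  let ?F = "free_terms \<Sigma> X"
  let ?C = "{\<theta>. is_congruence \<Sigma> X \<theta> \<and> S \<subseteq> \<theta>}"
  have "Op f ss \<in> ?F \<and> Op f ts \<in> ?F"
    if "f \<in> ops \<Sigma>" "length ss = arity \<Sigma> f" "list_all2 (\<lambda>s t. (s, t) \<in> ?F \<times> ?F) ss ts" for f ss ts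
    using that
    by (auto intro!: free_terms.Op simp: list_all2_conv_all_nth in_set_conv_nth)
  then have "is_congruence \<Sigma> X (?F \<times> ?F)"
    by (auto simp: is_congruence_def equiv_def refl_on_def sym_def trans_def)
  then have full: "?F \<times> ?F \<in> ?C" using assms by simp
  have eq: "equiv ?F \<theta>" if "\<theta> \<in> ?C" for \<theta>
    using that by (auto simp: is_congruence_def)
  have "equiv ?F (\<Inter> ?C)"
  proof (rule equivI)
    show "\<Inter> ?C \<subseteq> ?F \<times> ?F" using full by blast
    show "refl_on ?F (\<Inter> ?C)" using eq by (auto simp: refl_on_def equiv_def)
    show "sym (\<Inter> ?C)" using eq by (intro symI) (blast dest: equivE symD)
    show "trans (\<Inter> ?C)" using eq by (intro transI) (blast dest: equivE transD)
  qed
  moreover have "(Op f ss, Op f ts) \<in> \<Inter> ?C"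
    if "f \<in> ops \<Sigma>" "length ss = arity \<Sigma> f" "list_all2 (\<lambda>s t. (s, t) \<in> \<Inter> ?C) ss ts" for f ss ts
  proof
    fix \<theta> assume "\<theta> \<in> ?C"
    moreover from this have "list_all2 (\<lambda>s t. (s, t) \<in> \<theta>) ss ts"
      using that(3) by (auto elim!: list_all2_mono)
    ultimately show "(Op f ss, Op f ts) \<in> \<theta>"
      using that(1,2) unfolding is_congruence_def by blast
  qed
  ultimately show ?thesis
    unfolding is_congruence_def generated_congruence_def by blast
qed

lemma kernel_is_congruence:
  "is_congruence \<Sigma> X
     {(s, t) \<in> free_terms \<Sigma> X \<times> free_terms \<Sigma> X. term_val A v s = term_val A v t}"
    (is "is_congruence \<Sigma> X ?K")
  unfolding is_congruence_def
proof (intro conjI ballI allI impI)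
  show "equiv (free_terms \<Sigma> X) ?K"
    by (auto simp: equiv_def refl_on_def sym_def trans_def)
  fix f ss ts
  assume f: "f \<in> ops \<Sigma>" and *: "length ss = arity \<Sigma> f \<and> list_all2 (\<lambda>s t. (s, t) \<in> ?K) ss ts"
  then have "length ts = length ss" by (auto dest: list_all2_lengthD)
  moreover from * this have "map (term_val A v) ss = map (term_val A v) ts"
    by (auto simp: list_all2_conv_all_nth list_eq_iff_nth_eq)
  moreover have "Op f ss \<in> free_terms \<Sigma> X" "Op f ts \<in> free_terms \<Sigma> X"
    using * f calculation(1)
    by (auto intro!: free_terms.Op simp: list_all2_conv_all_nth in_set_conv_nth)
  ultimately show "(Op f ss, Op f ts) \<in> ?K" by (simp del: map_eq_conv)
qed

lemma word_congruence_is_congruence: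
  assumes "R \<subseteq> free_terms \<Sigma> X \<times> free_terms \<Sigma> X"
  shows "is_congruence \<Sigma> X (word_congruence \<Sigma> V X R)"
  unfolding word_congruence_def
  by (rule generated_congruence_is_congruence) (use assms in \<open>auto simp: valid_equations_def\<close>)

lemma relations_in_word_congruence: "R \<subseteq> word_congruence \<Sigma> V X R"
  by (auto simp: word_congruence_def generated_congruence_def)

text \<open>Closed terms lie in the free algebra over every \<open>X\<close>, so each law is a valid
  equation over each set of generators.\<close>

lemma laws_in_word_congruence:
  assumes "E \<subseteq> free_terms \<Sigma> {} \<times> free_terms \<Sigma> {}"
  shows "E \<subseteq> word_congruence \<Sigma> (variety \<Sigma> E) X R"
proof -
  have "E \<subseteq> valid_equations \<Sigma> (variety \<Sigma> E) X"
    using assms by (auto simp: valid_equations_def variety_def intro: free_terms_mono)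
  then show ?thesis by (auto simp: word_congruence_def generated_congruence_def)
qed

text \<open>The kernel of evaluation in a model is a congruence containing the relations and the
  valid equations. The model may have elements of any type, by
  \<open>valid_in_all_carrier_types\<close>. This is how terms are shown to be incongruent.\<close>

lemma word_congruence_sound:
  fixes A :: "'a algebra" and v :: "nat \<Rightarrow> 'a"
  assumes E: "E \<subseteq> free_terms \<Sigma> {} \<times> free_terms \<Sigma> {}"
    and R: "R \<subseteq> free_terms \<Sigma> X \<times> free_terms \<Sigma> X"
    and carrier: "carrier A = UNIV"
    and laws: "\<And>s t. (s, t) \<in> E \<Longrightarrow> term_val A v s = term_val A v t"
    and rels: "\<And>s t. (s, t) \<in> R \<Longrightarrow> term_val A v s = term_val A v t"
    and st: "(s, t) \<in> word_congruence \<Sigma> (variety \<Sigma> E :: nat algebra set) X R"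
  shows "term_val A v s = term_val A v t"
proof -
  let ?K = "{(s, t) \<in> free_terms \<Sigma> X \<times> free_terms \<Sigma> X. term_val A v s = term_val A v t}"
  have "satisfies A e" if "e \<in> E" for e
  proof -
    obtain s t where e: "e = (s, t)" by (cases e)
    \<comment> \<open>Laws are closed, so their truth under the one valuation \<open>v\<close> is
      their truth under all.\<close>
    have "term_val A w s = term_val A w t" for w
      using laws[of s t] term_val_closed[of s \<Sigma> A w v] term_val_closed[of t \<Sigma> A w v] E that e
      by auto
    then show ?thesis by (simp add: satisfies_def e)
  qed
  then have A: "A \<in> variety \<Sigma> E" by (simp add: variety_def is_algebra_def carrier)
  have E': "E \<subseteq> free_terms \<Sigma> UNIV \<times> free_terms \<Sigma> UNIV"
    using E by (blast intro: free_terms_mono)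
  have "valid_equations \<Sigma> (variety \<Sigma> E :: nat algebra set) X \<subseteq> ?K"
  proof
    fix e assume e: "e \<in> valid_equations \<Sigma> (variety \<Sigma> E :: nat algebra set) X"
    from valid_in_all_carrier_types[OF E' e A]
    have "term_val A v (fst e) = term_val A v (snd e)"
      by (simp add: satisfies_def carrier)
    then show "e \<in> ?K" using e by (auto simp: valid_equations_def)
  qed
  moreover have "R \<subseteq> ?K" using R rels by auto
  ultimately have "word_congruence \<Sigma> (variety \<Sigma> E :: nat algebra set) X R \<subseteq> ?K"
    using kernel_is_congruence[of \<Sigma> X A v]
    unfolding word_congruence_def generated_congruence_def by (intro Inter_lower) auto
  then show ?thesis using st by blast
qed

section \<open>The language and its laws\<close>

definition sig :: signature where
  "sig = \<lparr>ops = {0, 1, 2, 3}, arity = (\<lambda>f. if f = 0 then 0 else 1)\<rparr>"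

abbreviation un :: "nat \<Rightarrow> 'x trm \<Rightarrow> 'x trm" where
  "un f t \<equiv> Op f [t]"

abbreviation cst :: "'x trm" where
  "cst \<equiv> Op 0 []"

definition num :: "nat \<Rightarrow> 'x trm" where
  "num n = (un 1 ^^ n) cst"

definition chain :: "nat \<Rightarrow> nat \<Rightarrow> 'x trm" where
  "chain n m = (un 3 ^^ m) (un 2 (num n))"

text \<open>With \<open>Suc m\<close> every left-hand side is an application of operation 3, so
  rewriting by laws can be confined to that operation.\<close>

definition laws :: "nat equation set" where
  "laws = insert (un 3 cst, cst) {(chain n (Suc m), cst) | n m. halts0 n m}"

lemma un_in_free_terms_iff: "un f t \<in> free_terms sig X \<longleftrightarrow> f \<in> {1, 2, 3} \<and> t \<in> free_terms sig X"
  by (subst free_terms.simps) (auto simp: sig_def)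

lemma cst_in_free_terms [simp]: "cst \<in> free_terms sig X"
  by (rule free_terms.Op) (auto simp: sig_def)

lemma free_terms_sig_induct [consumes 1, case_names Var cst un]:
  assumes "t \<in> free_terms sig X"
    and "\<And>x. x \<in> X \<Longrightarrow> P (Var x)"
    and "P cst"
    and "\<And>f t. f \<in> {1, 2, 3} \<Longrightarrow> t \<in> free_terms sig X \<Longrightarrow> P t \<Longrightarrow> P (un f t)"
  shows "P t"
  using assms(1)
proof (induction t rule: free_terms.induct)
  case (Op f ts)
  show ?case
  proof (cases "f = 0")
    case True
    then show ?thesis using Op.hyps assms(3) by (simp add: sig_def)
  next
    case False
    then obtain t where "ts = [t]"
      using Op.hyps by (auto simp: sig_def length_Suc_conv)
    then show ?thesis using Op assms(4) False by (auto simp: sig_def)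
  qed
qed (rule assms(2))

lemma num_simps [simp]: "num 0 = cst" "num (Suc n) = un 1 (num n)"
  by (simp_all add: num_def)

lemma chain_simps [simp]: "chain n 0 = un 2 (num n)" "chain n (Suc m) = un 3 (chain n m)"
  by (simp_all add: chain_def)

lemma num_in_free_terms [simp]: "num n \<in> free_terms sig X"
  by (induction n) (auto simp: un_in_free_terms_iff)

lemma chain_in_free_terms [simp]: "chain n m \<in> free_terms sig X"
  by (induction m) (auto simp: un_in_free_terms_iff)

lemma laws_closed: "laws \<subseteq> free_terms sig {} \<times> free_terms sig {}"
  by (auto simp: laws_def un_in_free_terms_iff)

section \<open>The congruence of a fixed finite presentation\<close>

locale presentation =
  fixes X :: "nat set" and R :: "nat equation set"
  assumes finite_presentation: "finite_presentation sig X R"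
begin

definition \<theta> :: "nat equation set" where
  "\<theta> = word_congruence sig (variety sig laws :: nat algebra set) X R"

lemma finite_X: "finite X" and finite_R: "finite R"
  and R_closed: "R \<subseteq> free_terms sig X \<times> free_terms sig X"
  using finite_presentation by (auto simp: finite_presentation_def)

lemma congruence: "is_congruence sig X \<theta>"
  unfolding \<theta>_def by (rule word_congruence_is_congruence[OF R_closed])

lemma equiv_\<theta>: "equiv (free_terms sig X) \<theta>"
  using congruence by (simp add: is_congruence_def)

lemma \<theta>_refl: "t \<in> free_terms sig X \<Longrightarrow> (t, t) \<in> \<theta>"
  using equiv_\<theta> by (auto simp: equiv_def refl_on_def)

lemma \<theta>_sym: "(s, t) \<in> \<theta> \<Longrightarrow> (t, s) \<in> \<theta>"
  using equiv_\<theta> by (auto simp: equiv_def dest: symD)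

lemma \<theta>_trans [trans]: "(s, t) \<in> \<theta> \<Longrightarrow> (t, u) \<in> \<theta> \<Longrightarrow> (s, u) \<in> \<theta>"
  using equiv_\<theta> by (auto simp: equiv_def dest: transD)

lemma \<theta>_un: "f \<in> {1, 2, 3} \<Longrightarrow> (s, t) \<in> \<theta> \<Longrightarrow> (un f s, un f t) \<in> \<theta>"
  using congruence unfolding is_congruence_def
  by (elim conjE ballE[of _ _ f] allE[of _ "[s]"] allE[of _ "[t]"]) (auto simp: sig_def)

lemma \<theta>_relation: "(s, t) \<in> R \<Longrightarrow> (s, t) \<in> \<theta>"
  unfolding \<theta>_def using relations_in_word_congruence by blast

lemma \<theta>_law: "(s, t) \<in> laws \<Longrightarrow> (s, t) \<in> \<theta>"
  unfolding \<theta>_def using laws_in_word_congruence[OF laws_closed] by blast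

lemma \<theta>_halts0: "halts0 n m \<Longrightarrow> (chain n (Suc m), cst) \<in> \<theta>"
  by (rule \<theta>_law) (auto simp: laws_def)

lemma \<theta>_un3_cst: "(un 3 cst, cst) \<in> \<theta>"
  by (rule \<theta>_law) (auto simp: laws_def)

lemma \<theta>_chain: "(num n, num r) \<in> \<theta> \<Longrightarrow> (chain n m, chain r m) \<in> \<theta>"
  by (induction m) (auto intro: \<theta>_un)

text \<open>A chain that has reached 0 stays there, because 0 is a fixed point of operation
  3.\<close>

lemma \<theta>_chain_cst: "l \<le> m \<Longrightarrow> (chain n l, cst) \<in> \<theta> \<Longrightarrow> (chain n m, cst) \<in> \<theta>"
proof (induction m rule: dec_induct)
  case (step m)
  then have "(un 3 (chain n m), un 3 cst) \<in> \<theta>" by (auto intro: \<theta>_un)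
  from \<theta>_trans[OF this \<theta>_un3_cst] show ?case by simp
qed

end

text \<open>The reduction of the halting question. The relation makes all terms of the chain
  congruent, so a single law for \<open>n\<close> sends its first term to 0; if there is no such
  law, a model separates the two terms.\<close>

lemma collapsed_chain_iff:
  fixes n :: nat
  defines "R \<equiv> {(chain n 1, chain n 0)} :: nat equation set"
  shows "finite_presentation sig {} R"
    and "(chain n 0, cst) \<in> word_congruence sig (variety sig laws :: nat algebra set) {} R
      \<longleftrightarrow> (\<exists>m. halts0 n m)"
proof -
  show fp: "finite_presentation sig {} R"
    by (auto simp: finite_presentation_def R_def un_in_free_terms_iff)
  interpret presentation "{}" R by standard (rule fp)
  show "(chain n 0, cst) \<in> word_congruence sig (variety sig laws :: nat algebra set) {} R
      \<longleftrightarrow> (\<exists>m. halts0 n m)"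
  proof
    assume *: "(chain n 0, cst) \<in> word_congruence sig (variety sig laws :: nat algebra set) {} R"
    show "\<exists>m. halts0 n m"
    proof (rule ccontr)
      assume never: "\<nexists>m. halts0 n m"
      \<comment> \<open>Numerals take their own values, 2 is the indicator of \<open>n\<close> and 3
        the identity. The chain of \<open>n\<close> is constantly 1 and all others are constantly 0,
        so only a law for \<open>n\<close> could fail.\<close>
      define A :: "nat algebra" where
        "A = \<lparr>carrier = UNIV, interp = (\<lambda>f as. if f = 0 then 0 else if f = 1 then Suc (hd as)
            else if f = 2 then of_bool (hd as = n) else hd as)\<rparr>"
      have num: "term_val A v (num k) = k" for v and k
        by (induction k) (auto simp: A_def)
      have chain: "term_val A v (chain k m) = of_bool (k = n)" for v k m
        by (induction m) (auto simp: A_def num[unfolded A_def])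
      have laws: "term_val A (\<lambda>x. 0) s = term_val A (\<lambda>x. 0) t" if "(s, t) \<in> laws" for s t
        using that never unfolding laws_def
        by (auto simp: chain simp del: chain_simps) (auto simp: A_def)
      have rels: "term_val A (\<lambda>x. 0) s = term_val A (\<lambda>x. 0) t" if "(s, t) \<in> R" for s t
        using that by (auto simp: R_def chain simp del: chain_simps)
      have "term_val A (\<lambda>x :: nat. 0) (chain n 0) = term_val A (\<lambda>x :: nat. 0) cst"
        by (rule word_congruence_sound[OF laws_closed R_closed _ laws rels *]) (simp_all add: A_def)
      then show False unfolding chain by (simp add: A_def)
    qed
  next
    assume "\<exists>m. halts0 n m"
    then obtain m where m: "halts0 n m" by blast
    have 1: "(un 3 (chain n 0), chain n 0) \<in> \<theta>"
      by (rule \<theta>_relation) (simp add: R_def)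
    have "(chain n k, chain n 0) \<in> \<theta>" for k
    proof (induction k)
      case 0
      show ?case by (intro \<theta>_refl chain_in_free_terms)
    next
      case (Suc k)
      have "(un 3 (chain n k), un 3 (chain n 0)) \<in> \<theta>"
        by (rule \<theta>_un) (use Suc in auto)
      from \<theta>_trans[OF this 1] show ?case by simp
    qed
    from \<theta>_trans[OF \<theta>_sym[OF this] \<theta>_halts0[OF m]]
    show "(chain n 0, cst) \<in> word_congruence sig (variety sig laws :: nat algebra set) {} R"
      unfolding \<theta>_def .
  qed
qed

section \<open>Normal forms\<close>

fun subterms :: "'x trm \<Rightarrow> 'x trm set" where
  "subterms (Var x) = {Var x}"
| "subterms (Op f ts) = insert (Op f ts) (\<Union> (subterms ` set ts))"

lemma finite_subterms: "finite (subterms t)"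
  by (induction t) auto

lemma subterms_self: "t \<in> subterms t"
  by (cases t) auto

lemma subterms_un: "un f u \<in> subterms t \<Longrightarrow> u \<in> subterms t"
  by (induction t) (auto simp: subterms_self)

lemma subterms_closed: "t \<in> free_terms \<Sigma> X \<Longrightarrow> subterms t \<subseteq> free_terms \<Sigma> X"
  by (induction t rule: free_terms.induct) (auto intro: free_terms.intros)

text \<open>The core of the later table: generators, both sides of the relations and of the law for
  \<open>un 3 cst\<close>, with all subterms so that normal forms can be computed from the inside
  outwards.\<close>

lemma (in presentation) obtain_subterm_closed:
  obtains S where "finite S" "S \<subseteq> free_terms sig X" "\<And>f t. un f t \<in> S \<Longrightarrow> t \<in> S"
    "Var ` X \<subseteq> S" "un 3 cst \<in> S" "R \<subseteq> S \<times> S"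
proof
  let ?S = "\<Union> (subterms ` (insert (un 3 cst) (Var ` X \<union> fst ` R \<union> snd ` R)))"
  show "finite ?S"
    using finite_X finite_R by (auto simp: finite_subterms)
  show "?S \<subseteq> free_terms sig X"
    using R_closed
    by (intro UN_least subterms_closed) (auto simp: un_in_free_terms_iff intro: free_terms.Var)
  show "t \<in> ?S" if "un f t \<in> ?S" for f t
    using that subterms_un by blast
  show "Var ` X \<subseteq> ?S" using subterms_self by blast
  show "un 3 cst \<in> ?S" using subterms_self by blast
  show "R \<subseteq> ?S \<times> ?S" using subterms_self by force
qed

text \<open>The operations compute normal forms: the finitely many entries given by \<open>T\<close> are
  looked up, and the laws for the numerals in \<open>M\<close>, which \<open>T\<close> does not know, are applied as
  rewrite rules.\<close>

locale normal_forms = presentation +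
  fixes T :: "nat trm set" and M :: "nat set"
  assumes finite_T: "finite T"
    and T_closed: "T \<subseteq> free_terms sig X"
    and T_subterm: "un f t \<in> T \<Longrightarrow> t \<in> T"
    and Var_in_T: "x \<in> X \<Longrightarrow> Var x \<in> T"
    and un3_cst_in_T: "un 3 cst \<in> T"
    and R_in_T: "R \<subseteq> T \<times> T"
begin

lemma cst_in_T: "cst \<in> T"
  using un3_cst_in_T by (rule T_subterm)

lemma un_in_T: "un f t \<in> T \<Longrightarrow> f \<in> {1, 2, 3}"
  using T_closed un_in_free_terms_iff by blast

section \<open>Representatives and the operations on normal forms\<close>

definition rep :: "nat trm \<Rightarrow> nat trm" where
  "rep t = (SOME s. s \<in> T \<and> (t, s) \<in> \<theta>)"

lemma rep:
  assumes "s \<in> T" "(t, s) \<in> \<theta>"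
  shows "rep t \<in> T" "(rep t, t) \<in> \<theta>"
  unfolding atomize_conj rep_def
  using someI[of "\<lambda>s. s \<in> T \<and> (t, s) \<in> \<theta>" s] assms \<theta>_sym by blast

lemma rep_T: "t \<in> T \<Longrightarrow> rep t \<in> T \<and> (rep t, t) \<in> \<theta>"
  using rep[of t t] T_closed \<theta>_refl by blast

text \<open>Congruent terms give the same predicate to the choice operator, hence the same choice,
  even if no element of \<open>T\<close> satisfies it.\<close>

lemma rep_cong: "(s, t) \<in> \<theta> \<Longrightarrow> rep s = rep t"
proof -
  assume "(s, t) \<in> \<theta>"
  then have "(\<lambda>u. u \<in> T \<and> (s, u) \<in> \<theta>) = (\<lambda>u. u \<in> T \<and> (t, u) \<in> \<theta>)"
    using \<theta>_trans \<theta>_sym by blast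
  then show ?thesis by (simp add: rep_def)
qed

text \<open>For a key, \<open>un f u\<close> is congruent to an element of \<open>T\<close>. Keys
  lie in a finite set, so \<open>lookup\<close> differs from the free operation at finitely many
  places.\<close>

definition keys :: "(nat \<times> nat trm) set" where
  "keys = {(f, u). u \<in> T \<and> (\<exists>t. un f t \<in> T \<and> (u, t) \<in> \<theta>)}"

definition lookup :: "nat \<Rightarrow> nat trm \<Rightarrow> nat trm" where
  "lookup f u = (if (f, u) \<in> keys then rep (un f u) else un f u)"

definition nf_num :: "nat \<Rightarrow> nat trm" where
  "nf_num n = (lookup 1 ^^ n) (rep cst)"

text \<open>Left-hand sides of laws without their outermost operation 3, the numeral being replaced
  by its normal form.\<close>

definition special :: "nat trm set" where
  "special = {(un 3 ^^ m) (un 2 (nf_num n)) | n m. n \<in> M \<and> halts0 n m}"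

definition nf_un :: "nat \<Rightarrow> nat trm \<Rightarrow> nat trm" where
  "nf_un f u = (if f = 3 \<and> (f, u) \<notin> keys \<and> u \<in> special then rep cst else lookup f u)"

text \<open>With normalisation as evaluation in an algebra, congruent terms have equal normal forms
  as soon as this algebra satisfies the laws and relations.\<close>

definition nf_algebra :: "nat trm algebra" where
  "nf_algebra = \<lparr>carrier = UNIV,
     interp = (\<lambda>f us. case us of [] \<Rightarrow> rep cst | u # _ \<Rightarrow> nf_un f u)\<rparr>"

definition nf :: "nat trm \<Rightarrow> nat trm" where
  "nf = term_val nf_algebra (\<lambda>x. rep (Var x))"

lemma nf_simps [simp]: "nf (Var x) = rep (Var x)" "nf cst = rep cst" "nf (un f t) = nf_un f (nf t)"
  by (simp_all add: nf_def nf_algebra_def)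

lemma keysD:
  assumes "(f, u) \<in> keys"
  shows "f \<in> {1, 2, 3}" "rep (un f u) \<in> T" "(rep (un f u), un f u) \<in> \<theta>"
proof -
  obtain t where t: "un f t \<in> T" "(u, t) \<in> \<theta>" using assms by (auto simp: keys_def)
  show f: "f \<in> {1, 2, 3}" using t(1) by (rule un_in_T)
  have "(un f u, un f t) \<in> \<theta>" using f t(2) by (rule \<theta>_un)
  with t(1) show "rep (un f u) \<in> T" "(rep (un f u), un f u) \<in> \<theta>" by (rule rep)+
qed

lemma lookup_sound:
  assumes "f \<in> {1, 2, 3}" "(u, t) \<in> \<theta>"
  shows "(lookup f u, un f t) \<in> \<theta>"
  using keysD(3)[of f u] \<theta>_un[OF assms] \<theta>_trans by (auto simp: lookup_def)

lemma nf_num_sound: "(nf_num n, num n) \<in> \<theta>"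
  unfolding nf_num_def using rep_T[OF cst_in_T] by (induction n) (auto intro: lookup_sound)

lemma special_sound:
  assumes "u \<in> special"
  shows "(un 3 u, cst) \<in> \<theta>"
proof -
  obtain n m where u: "u = (un 3 ^^ m) (un 2 (nf_num n))" and h: "halts0 n m"
    using assms by (auto simp: special_def)
  have "((un 3 ^^ l) (un 2 (nf_num n)), chain n l) \<in> \<theta>" for l
    by (induction l) (auto intro: \<theta>_un nf_num_sound)
  then have "(un 3 u, chain n (Suc m)) \<in> \<theta>" by (auto simp: u intro: \<theta>_un)
  from \<theta>_trans[OF this \<theta>_halts0[OF h]] show ?thesis .
qed

lemma nf_sound: "t \<in> free_terms sig X \<Longrightarrow> (nf t, t) \<in> \<theta>"
proof (induction t rule: free_terms_sig_induct)
  case (Var x)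
  then show ?case using rep_T[OF Var_in_T] by simp
next
  case cst
  then show ?case using rep_T[OF cst_in_T] by simp
next
  case (un f t)
  show ?case
  proof (cases "f = 3 \<and> (f, nf t) \<notin> keys \<and> nf t \<in> special")
    case True
    then have "(rep cst, un 3 (nf t)) \<in> \<theta>"
      using \<theta>_trans[OF conjunct2[OF rep_T[OF cst_in_T]] \<theta>_sym[OF special_sound]] by blast
    from \<theta>_trans[OF this, of "un 3 t"] True un.IH show ?thesis
      by (auto simp: nf_un_def intro: \<theta>_un)
  next
    case False
    then show ?thesis using lookup_sound[OF un.hyps(1) un.IH] by (auto simp: nf_un_def)
  qed
qed

text \<open>Since \<open>s\<close> is congruent to \<open>t\<close>, the pair of \<open>f\<close>
  and the representative of \<open>s\<close> is a key, so the value is looked up. It is enough that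
  \<open>T\<close> contains the operation applied to some term congruent to
  \<open>s\<close>.\<close>

lemma nf_un_eq_rep:
  assumes "nf s = rep s" "(s, t) \<in> \<theta>" "un f t \<in> T"
  shows "nf (un f s) = rep (un f s)"
proof -
  have t: "t \<in> T" using assms(3) by (rule T_subterm)
  have rep: "rep s \<in> T" "(rep s, s) \<in> \<theta>" using t assms(2) by (rule rep)+
  then have "(f, rep s) \<in> keys"
    using assms(2,3) \<theta>_trans by (auto simp: keys_def)
  moreover have "(un f (rep s), un f s) \<in> \<theta>"
    using un_in_T[OF assms(3)] rep(2) by (rule \<theta>_un)
  ultimately show ?thesis
    using assms(1) rep_cong by (simp add: nf_un_def lookup_def)
qed

lemma nf_T: "t \<in> T \<Longrightarrow> nf t = rep t"
proof -
  assume "t \<in> T"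
  then have "t \<in> free_terms sig X" using T_closed by blast
  then show ?thesis using \<open>t \<in> T\<close>
  proof (induction t rule: free_terms_sig_induct)
    case (un f t)
    have "nf t = rep t" using un.IH T_subterm[OF un.prems] .
    then show ?case using \<theta>_refl[OF un.hyps(2)] un.prems by (rule nf_un_eq_rep)
  qed simp_all
qed

text \<open>The chain of \<open>n\<close> follows the tabulated chain of the congruent numeral
  \<open>r\<close> up to a place where that one is 0, so the law is a consequence of table
  entries.\<close>

lemma nf_law_known:
  assumes "nf (num n) = rep (num n)" "(num n, num r) \<in> \<theta>"
    and "\<And>l. l \<le> k \<Longrightarrow> chain r l \<in> T" "(chain r k, cst) \<in> \<theta>"
    and "halts0 n m"
  shows "nf (chain n (Suc m)) = rep cst"
proof -
  have "nf (chain n l) = rep (chain n l)" for l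
  proof (induction l)
    case 0
    show ?case using nf_un_eq_rep[OF assms(1,2)] assms(3)[of 0] by (simp del: nf_simps)
  next
    case (Suc l)
    show ?case
    proof (cases "Suc l \<le> k")
      case True
      then show ?thesis
        using nf_un_eq_rep[OF Suc \<theta>_chain[OF assms(2)]] assms(3)[of "Suc l"]
        by (simp del: nf_simps)
    next
      case False
      \<comment> \<open>Past the tabulated part the chain is congruent to 0, and the entry
        \<open>un 3 cst\<close> takes over.\<close>
      then have "(chain r l, cst) \<in> \<theta>" using \<theta>_chain_cst[OF _ assms(4)] by simp
      then have "(chain n l, cst) \<in> \<theta>" using \<theta>_trans[OF \<theta>_chain[OF assms(2)]] by blast
      from nf_un_eq_rep[OF Suc this un3_cst_in_T] show ?thesis by simp
    qed
  qed
  then show ?thesis using rep_cong[OF \<theta>_halts0[OF assms(5)]] by metis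
qed

text \<open>If the first term of the chain is outside the table, so are all later ones, as
  \<open>T\<close> is closed under subterms. The chain then grows freely until a law sends it to
  0.\<close>

lemma nf_law_special:
  assumes n: "n \<in> M" and nf: "nf (num n) = nf_num n"
    and new: "\<And>t. un 2 t \<in> T \<Longrightarrow> (num n, t) \<notin> \<theta>"
    and h: "halts0 n m"
  shows "nf (chain n (Suc m)) = rep cst"
proof -
  define c where "c l = (un 3 ^^ l) (un 2 (nf_num n))" for l
  have c_notin: "c l \<notin> T" for l
  proof (induction l)
    case 0
    show ?case using new[of "nf_num n"] \<theta>_sym[OF nf_num_sound] by (auto simp: c_def)
  next
    case (Suc l)
    then show ?case using T_subterm by (auto simp: c_def)
  qed
  have cst: "nf_un 3 (rep cst) = rep cst"
    using nf_un_eq_rep[OF _ \<theta>_refl un3_cst_in_T] rep_cong[OF \<theta>_un3_cst] by simp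
  have "(2, nf_num n) \<notin> keys"
    using new \<theta>_trans[OF \<theta>_sym[OF nf_num_sound]] by (auto simp: keys_def)
  then have 0: "nf (chain n 0) = c 0"
    by (simp add: nf nf_un_def lookup_def c_def)
  have *: "nf_un 3 (c l) = (if c l \<in> special then rep cst else c (Suc l))" for l
    using c_notin by (simp add: nf_un_def lookup_def keys_def c_def)
  \<comment> \<open>A law with a smaller index may already have sent the chain to 0, where it then
    remains.\<close>
  have "nf (chain n l) \<in> {c l, rep cst}" for l
    by (induction l) (use 0 * cst in auto)
  moreover have "c m \<in> special" using n h by (auto simp: special_def c_def)
  ultimately show ?thesis using *[of m] cst by (metis chain_simps(2) insertE nf_simps(3) singletonD)
qed

text \<open>Soundness of \<open>nf\<close> gives one direction. For the other,
  \<open>nf_algebra\<close> is a model: the sides of a relation lie in \<open>T\<close>, where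
  \<open>nf\<close> is \<open>rep\<close>, and the laws hold by assumption.\<close>

lemma \<theta>_iff_nf:
  assumes laws: "\<And>n m. halts0 n m \<Longrightarrow> nf (chain n (Suc m)) = rep cst"
    and st: "s \<in> free_terms sig X" "t \<in> free_terms sig X"
  shows "(s, t) \<in> \<theta> \<longleftrightarrow> nf s = nf t"
proof
  assume "nf s = nf t"
  then show "(s, t) \<in> \<theta>"
    using \<theta>_trans[OF \<theta>_sym[OF nf_sound[OF st(1)]]] nf_sound[OF st(2)] by simp
next
  assume *: "(s, t) \<in> \<theta>"
  have "nf s = nf t" if "(s, t) \<in> R" for s t
    using that R_in_T nf_T rep_cong[OF \<theta>_relation] by auto
  moreover have "nf (un 3 cst) = nf cst"
    unfolding nf_T[OF un3_cst_in_T] nf_T[OF cst_in_T] by (rule rep_cong[OF \<theta>_un3_cst])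
  then have "nf s = nf t" if "(s, t) \<in> laws" for s t
    using that laws unfolding laws_def by (auto simp del: chain_simps nf_simps(3))
  ultimately show "nf s = nf t"
    using * unfolding nf_def \<theta>_def
    by - (rule word_congruence_sound[OF laws_closed R_closed], auto simp: nf_algebra_def)
qed

end

section \<open>Evaluation of terms on their codes\<close>

definition un_code :: "nat \<Rightarrow> nat \<Rightarrow> nat" where
  "un_code f c = sum_encode (Inr (prod_encode (f, list_encode [c])))"

lemma trm_code_un: "trm_code (un f t) = un_code f (trm_code t)"
  by (simp add: un_code_def)

lemma trm_code_un_funpow: "trm_code ((un f ^^ n) t) = (un_code f ^^ n) (trm_code t)"
  by (induction n) (auto simp: trm_code_un simp del: trm_code.simps)

text \<open>Codes grow with each operation, so the code of a term bounds its depth and thereby the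
  searches and iterations below.\<close>

lemma un_code_greater: "c < un_code f c"
proof -
  have "c \<le> list_encode [c]" using le_prod_encode_1[of c 0] by simp
  also have "\<dots> \<le> prod_encode (f, list_encode [c])" by (rule le_prod_encode_2)
  finally show ?thesis by (simp add: un_code_def sum_encode_def)
qed

lemma un_code_funpow_ge: "n + c \<le> (un_code f ^^ n) c"
proof (induction n)
  case (Suc n)
  then show ?case using un_code_greater[of "(un_code f ^^ n) c" f] by simp
qed simp

lemma computable_un_code [computable_intros]:
  "computable f \<Longrightarrow> computable c \<Longrightarrow> computable (\<lambda>x. un_code (f x) (c x))"
  unfolding un_code_def sum_encode_def sum.case by (intro computable_intros)

lemma trm_code_eq_iff: "trm_code s = trm_code t \<longleftrightarrow> s = t"
  using inj_trm_code by (auto simp: inj_def)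

text \<open>Even codes belong to generators; these and the constant are left fixed. Otherwise the
  outermost operation is moved to the word, so the innermost one comes to stand first.\<close>

definition peel :: "nat \<times> nat list \<Rightarrow> nat \<times> nat list" where
  "peel = (\<lambda>(c, fs). if c = 2 * (c div 2) then (c, fs)
     else case prod_decode (c div 2) of (f, l) \<Rightarrow>
       (case list_decode l of [] \<Rightarrow> (c, fs) | d # _ \<Rightarrow> (d, f # fs)))"

definition rebuild :: "(nat \<Rightarrow> nat \<Rightarrow> nat) \<Rightarrow> nat \<times> nat list \<Rightarrow> nat \<times> nat list" where
  "rebuild g = (\<lambda>(v, fs). case fs of [] \<Rightarrow> (v, fs) | f # fs' \<Rightarrow> (g f v, fs'))"

text \<open>Every operation being unary, a term is a generator or the constant below a word of operations.
  The code of the term bounds the length of that word, hence the number of iterations.\<close>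

definition eval_code :: "(nat \<Rightarrow> nat \<Rightarrow> nat) \<Rightarrow> (nat \<Rightarrow> nat) \<Rightarrow> nat \<Rightarrow> nat" where
  "eval_code g b c =
     fst ((rebuild g ^^ c) (case (peel ^^ c) (c, []) of (d, fs) \<Rightarrow> (b d, fs)))"

lemma computable_eval_code:
  assumes "computable (\<lambda>z. g (fst z) (snd z))" "computable b"
  shows "computable (eval_code g b)"
proof -
  have "computable (\<lambda>x. eval_code g b x)"
    unfolding eval_code_def rebuild_def peel_def case_prod_beta
    by (intro computable_uncurry[where f = g, OF assms(1)] computable_compose[OF assms(2)]
        computable_intros)
  then show ?thesis .
qed

lemma peel_word:
  "(peel ^^ length fs) (trm_code (foldl (\<lambda>t f. un f t) t fs), gs) = (trm_code t, fs @ gs)"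
proof (induction fs arbitrary: gs rule: rev_induct)
  case (snoc f fs)
  have "peel (trm_code (un f u), gs) = (trm_code u, f # gs)" for u
    by (simp add: peel_def sum_encode_def)
  then show ?case using snoc by (simp add: funpow_Suc_right del: trm_code.simps funpow.simps)
qed simp

lemma rebuild_word: "(rebuild g ^^ length fs) (v, fs) = (foldl (\<lambda>v f. g f v) v fs, [])"
  by (induction fs arbitrary: v) (auto simp: rebuild_def funpow_swap1)

lemma length_le_trm_code: "length fs \<le> trm_code (foldl (\<lambda>t f. un f t) t fs)"
proof (induction fs rule: rev_induct)
  case (snoc f fs)
  then show ?case
    using un_code_greater[of "trm_code (foldl (\<lambda>t f. un f t) t fs)" f]
    by (simp add: trm_code_un del: trm_code.simps)
qed simp

text \<open>Lets the code of a term serve as the number of iterations when fewer already reach the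
  result.\<close>

lemma funpow_fixpoint:
  assumes "(f ^^ k) x = y" "f y = y" "k \<le> n"
  shows "(f ^^ n) x = y"
  using assms(3) by (induction n rule: dec_induct) (auto simp: assms)

lemma eval_code:
  assumes "(\<exists>x. t = Var x) \<or> t = cst"
  shows "eval_code g b (trm_code (foldl (\<lambda>t f. un f t) t fs))
    = foldl (\<lambda>v f. g f v) (b (trm_code t)) fs"
proof -
  let ?c = "trm_code (foldl (\<lambda>t f. un f t) t fs)"
  have "peel (trm_code t, fs) = (trm_code t, fs)"
    using assms by (auto simp: peel_def sum_encode_def)
  then have "(peel ^^ ?c) (?c, []) = (trm_code t, fs)"
    using peel_word[of fs t "[]"] by (intro funpow_fixpoint[OF _ _ length_le_trm_code]) auto
  moreover have "(rebuild g ^^ ?c) (b (trm_code t), fs)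
      = (foldl (\<lambda>v f. g f v) (b (trm_code t)) fs, [])"
    by (rule funpow_fixpoint[OF rebuild_word _ length_le_trm_code]) (simp add: rebuild_def)
  ultimately show ?thesis by (simp add: eval_code_def)
qed

lemma free_terms_word:
  assumes "t \<in> free_terms sig X"
  obtains s fs where "t = foldl (\<lambda>t f. un f t) s fs" "s \<in> insert cst (Var ` X)"
  using assms
proof (induction t arbitrary: thesis rule: free_terms_sig_induct)
  case (Var x)
  then show ?case by (metis foldl_Nil imageI insertI2)
next
  case cst
  then show ?case by (metis foldl_Nil insertI1)
next
  case (un f t)
  obtain s fs where "t = foldl (\<lambda>t f. un f t) s fs" "s \<in> insert cst (Var ` X)"
    using un.IH by blast
  then show ?case using un.prems[of s "fs @ [f]"] by simp
qed

section \<open>The word problem\<close>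

text \<open>All knowledge about \<open>T\<close> enters through finite updates. What remains is
  membership in \<open>special\<close>, which \<open>bound\<close> turns into a bounded
  search.\<close>

lemma (in normal_forms) computable_nf:
  assumes M: "computable (\<lambda>n. n \<in> M)"
    and bound: "\<And>n. n \<in> M \<Longrightarrow> n \<le> trm_code (nf_num n) + C"
  obtains h where "computable h" "\<And>t. t \<in> free_terms sig X \<Longrightarrow> h (trm_code t) = trm_code (nf t)"
proof -
  \<comment> \<open>This inverse is evaluated only at the finitely many places of an update, where
    its values are constants.\<close>
  define decode where "decode = inv (trm_code :: nat trm \<Rightarrow> nat)"
  have decode: "decode (trm_code t) = t" for t
    by (simp add: decode_def inj_trm_code)
  define F where "F = map_prod id trm_code ` keys"
  have F: "(f, trm_code u) \<in> F \<longleftrightarrow> (f, u) \<in> keys" for f u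
    by (force simp: F_def trm_code_eq_iff)
  have "keys \<subseteq> {1, 2, 3} \<times> T"
    using keysD(1) by (auto simp: keys_def)
  then have "finite F"
    unfolding F_def using finite_T by (meson finite_SigmaI finite.intros finite_imageI finite_subset)
  define lk where
    "lk f c = (if (f, c) \<in> F then trm_code (rep (un f (decode c))) else un_code f c)" for f c
  have "computable (\<lambda>z. if z \<in> F then trm_code (rep (un (fst z) (decode (snd z))))
      else un_code (fst z) (snd z))"
    by (intro computable_finite_update \<open>finite F\<close> computable_intros)
  then have computable_lk: "computable (\<lambda>z. lk (fst z) (snd z))"
    by (simp add: lk_def)
  have "computable (\<lambda>z. if z \<in> F then True else False)"
    by (intro computable_finite_update \<open>finite F\<close> computable_intros)
  then have computable_F: "computable (\<lambda>z. (fst z, snd z) \<in> F)"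
    by (simp add: if_bool_eq_disj)
  have lk: "lk f (trm_code u) = trm_code (lookup f u)" for f u
    by (simp add: lk_def lookup_def F decode trm_code_un del: trm_code.simps)
  define ns where "ns n = (lk 1 ^^ n) (trm_code (rep cst))" for n
  have ns: "ns n = trm_code (nf_num n)" for n
    unfolding ns_def nf_num_def by (induction n) (simp_all add: lk)
  have computable_ns: "computable (\<lambda>n. ns n)"
    unfolding ns_def
    by (intro computable_uncurry[where f = lk, OF computable_lk] computable_intros)
  \<comment> \<open>For a solution, \<open>m\<close> and \<open>ns n\<close> are at most
    \<open>c\<close>, because codes grow, and \<open>n\<close> exceeds \<open>ns n\<close> by at
    most \<open>C\<close>.\<close>
  define sp where "sp c = (\<exists>n < Suc (c + C). \<exists>m < Suc c.
      n \<in> M \<and> halts0 n m \<and> (un_code 3 ^^ m) (un_code 2 (ns n)) = c)" for c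
  have computable_sp: "computable (\<lambda>c. sp c)"
    unfolding sp_def
    by (intro computable_compose[OF M] computable_compose[OF computable_ns] computable_intros)
  have sp: "sp (trm_code u) \<longleftrightarrow> u \<in> special" for u
  proof
    assume "sp (trm_code u)"
    then obtain n m where "n \<in> M" "halts0 n m"
      and "trm_code u = (un_code 3 ^^ m) (un_code 2 (ns n))"
      by (auto simp: sp_def)
    moreover from this(3) have "trm_code u = trm_code ((un 3 ^^ m) (un 2 (nf_num n)))"
      by (simp only: ns trm_code_un[symmetric] trm_code_un_funpow[symmetric])
    ultimately show "u \<in> special"
      unfolding trm_code_eq_iff special_def by blast
  next
    assume "u \<in> special"
    then obtain n m where n: "n \<in> M" and h: "halts0 n m"
      and u: "u = (un 3 ^^ m) (un 2 (nf_num n))"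
      by (auto simp: special_def)
    have c: "(un_code 3 ^^ m) (un_code 2 (ns n)) = trm_code u"
      by (simp only: u ns trm_code_un[symmetric] trm_code_un_funpow[symmetric])
    have "m + un_code 2 (ns n) \<le> trm_code u"
      using un_code_funpow_ge[of m "un_code 2 (ns n)" 3] by (simp only: c)
    moreover have "n \<le> ns n + C" using bound[OF n] by (simp add: ns)
    moreover have "ns n < un_code 2 (ns n)" by (rule un_code_greater)
    ultimately have "n < Suc (trm_code u + C)" "m < Suc (trm_code u)" by linarith+
    then show "sp (trm_code u)" unfolding sp_def using n h c by blast
  qed
  define g where "g f c = (if f = 3 \<and> (f, c) \<notin> F \<and> sp c then trm_code (rep cst) else lk f c)" for f c
  have computable_g: "computable (\<lambda>z. g (fst z) (snd z))"
    unfolding g_def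
    by (intro computable_F computable_lk computable_compose[OF computable_sp] computable_intros)
  have g: "g f (trm_code u) = trm_code (nf_un f u)" for f u
    by (auto simp: g_def F sp lk nf_un_def)
  define B :: "nat trm set" where "B = insert cst (Var ` X)"
  \<comment> \<open>The default 0 is never met on terms over \<open>X\<close>, whose innermost term
    lies in \<open>B\<close>.\<close>
  define b where "b c = (if c \<in> trm_code ` B then trm_code (nf (decode c)) else 0)" for c
  have "computable (\<lambda>c. b c)"
    unfolding b_def
    by (intro computable_finite_update computable_intros) (simp add: B_def finite_X)
  then have "computable (eval_code g b)"
    by (intro computable_eval_code computable_g)
  moreover have "eval_code g b (trm_code t) = trm_code (nf t)" if t: "t \<in> free_terms sig X" for t
  proof -
    obtain s fs where t: "t = foldl (\<lambda>t f. un f t) s fs" and s: "s \<in> B"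
      using free_terms_word[OF t] by (auto simp: B_def)
    have "eval_code g b (trm_code t) = foldl (\<lambda>v f. g f v) (trm_code (nf s)) fs"
      unfolding t using s by (subst eval_code) (auto simp: B_def b_def decode)
    also have "\<dots> = trm_code (foldl (\<lambda>u f. nf_un f u) (nf s) fs)"
      by (induction fs rule: rev_induct) (simp_all add: g)
    also have "foldl (\<lambda>u f. nf_un f u) (nf s) fs = nf t"
      unfolding t by (induction fs rule: rev_induct) simp_all
    finally show ?thesis .
  qed
  ultimately show thesis by (rule that)
qed

lemma (in normal_forms) word_problem_of_laws:
  assumes "computable (\<lambda>n. n \<in> M)"
    and "\<And>n. n \<in> M \<Longrightarrow> n \<le> trm_code (nf_num n) + C"
    and laws: "\<And>n m. halts0 n m \<Longrightarrow> nf (chain n (Suc m)) = rep cst"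
  shows "\<exists>p. \<forall>s\<in>free_terms sig X. \<forall>t\<in>free_terms sig X.
    computes p [trm_code s, trm_code t] (of_bool ((s, t) \<in> \<theta>))"
proof -
  obtain h where h: "computable h"
    "\<And>t. t \<in> free_terms sig X \<Longrightarrow> h (trm_code t) = trm_code (nf t)"
    using computable_nf[OF assms(1,2)] by blast
  have "computable (\<lambda>z. of_bool (h (fst z) = h (snd z)) :: nat)"
    by (intro computable_compose[OF h(1)] computable_intros)
  then obtain p where p: "\<And>c d. computes p [c, d] (of_bool (h c = h d))"
    by (rule computes_of_computable2[where f = "\<lambda>c d. of_bool (h c = h d)"]) blast
  have "computes p [trm_code s, trm_code t] (of_bool ((s, t) \<in> \<theta>))"
    if "s \<in> free_terms sig X" "t \<in> free_terms sig X" for s t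
    using p[of "trm_code s" "trm_code t"] \<theta>_iff_nf[OF laws that] h(2) that
    by (simp add: trm_code_eq_iff)
  then show ?thesis by blast
qed

section \<open>The table for a given presentation\<close>

context presentation
begin

text \<open>Some place where the chain of \<open>r\<close> is 0, if there is one. It is found by
  choice, not by computation, and serves only to delimit a finite table.\<close>

definition collapse :: "nat \<Rightarrow> nat" where
  "collapse r = (if \<exists>l. (chain r l, cst) \<in> \<theta> then SOME l. (chain r l, cst) \<in> \<theta> else 0)"

lemma collapse:
  assumes "halts0 n m" "(num n, num r) \<in> \<theta>"
  shows "(chain r (collapse r), cst) \<in> \<theta>"
proof -
  have "(chain r (Suc m), cst) \<in> \<theta>"
    using \<theta>_trans[OF \<theta>_sym[OF \<theta>_chain[OF assms(2)]] \<theta>_halts0[OF assms(1)]] .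
  then have ex: "\<exists>l. (chain r l, cst) \<in> \<theta>" by blast
  then show ?thesis using someI_ex[OF ex] by (simp add: collapse_def)
qed

text \<open>The numeral of \<open>N\<close> itself is included, so that each numeral with a
  tabulated chain has its successor in the table.\<close>

definition table :: "nat trm set \<Rightarrow> nat \<Rightarrow> nat trm set" where
  "table S N = S \<union> num ` {..N} \<union> (\<Union>r<N. chain r ` {..collapse r})"

lemma num_eq_un: "num n = un f t \<longleftrightarrow> f = 1 \<and> (\<exists>m. n = Suc m \<and> t = num m)"
  by (cases n) auto

lemma chain_eq_un: "chain r l = un f t \<longleftrightarrow>
    (l = 0 \<and> f = 2 \<and> t = num r) \<or> (f = 3 \<and> (\<exists>k. l = Suc k \<and> t = chain r k))"
  by (cases l) auto

lemma un2_in_table: "un 2 t \<in> table S N \<Longrightarrow> un 2 t \<in> S \<or> (\<exists>r<N. t = num r)"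
  by (auto simp: table_def image_iff num_eq_un chain_eq_un eq_commute[of "un 2 t"])

lemma normal_forms_table:
  assumes "finite S" "S \<subseteq> free_terms sig X" "\<And>f t. un f t \<in> S \<Longrightarrow> t \<in> S"
    and "Var ` X \<subseteq> S" "un 3 cst \<in> S" "R \<subseteq> S \<times> S"
  shows "normal_forms X R (table S N)"
proof
  show "t \<in> table S N" if "un f t \<in> table S N" for f t
  proof -
    consider "un f t \<in> S" | n where "n \<le> N" "num n = un f t"
      | r l where "r < N" "l \<le> collapse r" "chain r l = un f t"
      using \<open>un f t \<in> table S N\<close> by (auto simp: table_def)
    then show ?thesis
    proof cases
      case 1
      then show ?thesis using assms(3) by (auto simp: table_def)
    next
      case 2
      then show ?thesis by (auto simp: table_def num_eq_un)
    next
      case 3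
      then show ?thesis by (fastforce simp: table_def chain_eq_un)
    qed
  qed
qed (use assms in \<open>auto simp: table_def\<close>)

text \<open>When numerals are pairwise incongruent, each term is congruent to at most one of
  them.\<close>

lemma finitely_many_known_numerals:
  assumes "\<And>i j. i < j \<Longrightarrow> (num i, num j) \<notin> \<theta>" "finite S"
  shows "\<exists>N. \<forall>n\<ge>N. \<forall>t\<in>S. (num n, t) \<notin> \<theta>"
proof -
  have inj: "i = j" if "(num i, t) \<in> \<theta>" "(num j, t) \<in> \<theta>" for i j t
    using assms(1)[of i j] assms(1)[of j i] \<theta>_trans[OF that(1) \<theta>_sym[OF that(2)]] \<theta>_sym
    by (cases i j rule: linorder_cases) auto
  have "finite {n. (num n, t) \<in> \<theta>}" for t
  proof (cases "\<exists>n. (num n, t) \<in> \<theta>")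
    case True
    then obtain n where "(num n, t) \<in> \<theta>" by blast
    then have "{n. (num n, t) \<in> \<theta>} \<subseteq> {n}" using inj by blast
    then show ?thesis by (rule finite_subset) simp
  qed simp
  then have "finite (\<Union>t\<in>S. {n. (num n, t) \<in> \<theta>})" using assms(2) by blast
  then obtain N where "\<And>n. n \<in> (\<Union>t\<in>S. {n. (num n, t) \<in> \<theta>}) \<Longrightarrow> n < N"
    by (meson finite_nat_iff_bounded lessThan_iff subsetD)
  then show ?thesis by (intro exI[of _ N]) fastforce
qed

end

text \<open>From some \<open>C\<close> on, numerals are congruent to nothing in the table, so each
  further step adds an operation to the normal form and raises its code by at least 1. Below
  \<open>C\<close> the inequality is trivial.\<close>

lemma (in normal_forms) nf_num_bound:
  assumes "\<And>i j. i < j \<Longrightarrow> (num i, num j) \<notin> \<theta>"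
  obtains C where "\<And>n. n \<le> trm_code (nf_num n) + C"
proof -
  obtain C where C: "\<And>n t. n \<ge> C \<Longrightarrow> t \<in> T \<Longrightarrow> (num n, t) \<notin> \<theta>"
    using finitely_many_known_numerals[OF assms finite_T] by blast
  have "(1, nf_num n) \<notin> keys" if "n \<ge> C" for n
    using C[OF that, of "nf_num n"] \<theta>_sym[OF nf_num_sound] by (auto simp: keys_def)
  then have step: "nf_num (Suc n) = un 1 (nf_num n)" if "n \<ge> C" for n
    using that by (simp add: nf_num_def lookup_def)
  have "n \<le> trm_code (nf_num n) + C" if "n \<ge> C" for n
    using that
  proof (induction n rule: dec_induct)
    case (step n)
    then show ?case
      using un_code_greater[of "trm_code (nf_num n)" 1] \<open>\<And>n. C \<le> n \<Longrightarrow> nf_num (Suc n) = _ n\<close>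
      by (simp add: trm_code_un del: trm_code.simps)
  qed simp
  then have "n \<le> trm_code (nf_num n) + C" for n
    by (cases "n \<ge> C") auto
  then show thesis by (rule that)
qed

lemma (in presentation) word_problem:
  "\<exists>p. \<forall>s\<in>free_terms sig X. \<forall>t\<in>free_terms sig X.
    computes p [trm_code s, trm_code t] (of_bool ((s, t) \<in> \<theta>))"
proof -
  obtain S where S: "finite S" "S \<subseteq> free_terms sig X" "\<And>f t. un f t \<in> S \<Longrightarrow> t \<in> S"
    "Var ` X \<subseteq> S" "un 3 cst \<in> S" "R \<subseteq> S \<times> S"
    by (rule obtain_subterm_closed) (rule that)
  show ?thesis
  proof (cases "\<exists>i j. i < j \<and> (num i, num j) \<in> \<theta>")
    case True
    then obtain i j where ij: "i < j" "(num i, num j) \<in> \<theta>" by blast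
    \<comment> \<open>Every numeral will be congruent to one below \<open>j\<close>, whose chain is
      tabulated. With an empty \<open>M\<close> the table alone must account for all laws.\<close>
    interpret normal_forms X R "table S j" "{}"
      using S by (rule normal_forms_table)
    have *: "nf (num n) = rep (num n) \<and> (\<exists>r<j. (num n, num r) \<in> \<theta>)" for n
    proof (induction n)
      case 0
      show ?case using ij(1) \<theta>_refl[of cst] by (auto intro!: exI[of _ 0])
    next
      case (Suc n)
      then obtain r where r: "r < j" "(num n, num r) \<in> \<theta>" by blast
      have "num (Suc r) \<in> table S j" using r(1) by (auto simp: table_def simp del: num_simps)
      then have "nf (num (Suc n)) = rep (num (Suc n))"
        using nf_un_eq_rep[OF conjunct1[OF Suc] r(2)] by simp
      moreover have "(num (Suc n), num (Suc r)) \<in> \<theta>" using r(2) by (auto intro: \<theta>_un)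
      \<comment> \<open>When the successor reaches \<open>j\<close>, it wraps around to
        \<open>i\<close>, which is below \<open>j\<close>.\<close>
      then have "\<exists>r<j. (num (Suc n), num r) \<in> \<theta>"
        using r(1) ij \<theta>_trans[OF _ \<theta>_sym[OF ij(2)]] by (cases "Suc r = j") (blast, metis Suc_lessI)
      ultimately show ?case by blast
    qed
    have "nf (chain n (Suc m)) = rep cst" if h: "halts0 n m" for n m
    proof -
      obtain r where r: "r < j" "(num n, num r) \<in> \<theta>" using * by blast
      show ?thesis
      proof (rule nf_law_known[OF _ r(2) _ collapse[OF h r(2)] h])
        show "nf (num n) = rep (num n)" using * by blast
        show "chain r l \<in> table S j" if "l \<le> collapse r" for l
          using that r(1) by (auto simp: table_def simp del: chain_simps)
      qed
    qed
    then show ?thesis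
      by (intro word_problem_of_laws[where C = 0]) (simp_all add: computable_const)
  next
    case False
    then have distinct: "\<And>i j. i < j \<Longrightarrow> (num i, num j) \<notin> \<theta>" by blast
    obtain N where N: "\<And>n t. n \<ge> N \<Longrightarrow> t \<in> S \<Longrightarrow> (num n, t) \<notin> \<theta>"
      using finitely_many_known_numerals[OF distinct S(1)] by blast
    \<comment> \<open>The chains of numerals below \<open>N\<close> are tabulated; those from
      \<open>N\<close> on are treated by rewriting.\<close>
    interpret normal_forms X R "table S N" "{N..}"
      using S by (rule normal_forms_table)
    obtain C where C: "\<And>n. n \<le> trm_code (nf_num n) + C"
      using nf_num_bound[OF distinct] by blast
    have "nf (chain n (Suc m)) = rep cst" if h: "halts0 n m" for n m
    proof (cases "n < N")
      case True
      have r: "(num n, num n) \<in> \<theta>" by (intro \<theta>_refl num_in_free_terms)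
      show ?thesis
      proof (rule nf_law_known[OF _ r _ collapse[OF h r] h])
        show "nf (num n) = rep (num n)"
          by (rule nf_T) (use True in \<open>auto simp: table_def\<close>)
        show "chain n l \<in> table S N" if "l \<le> collapse n" for l
          using that True by (auto simp: table_def simp del: chain_simps)
      qed
    next
      case False
      \<comment> \<open>Either \<open>t\<close> is in \<open>S\<close>, which the choice of
        \<open>N\<close> excludes, or \<open>t\<close> is a numeral below \<open>N\<close> and hence
        incongruent to that of \<open>n\<close>.\<close>
      have "(num n, t) \<notin> \<theta>" if "un 2 t \<in> table S N" for t
        using un2_in_table[OF that] N[of n t] S(3) distinct[of _ n] \<theta>_sym False by fastforce
      moreover have "nf (num k) = nf_num k" for k
        unfolding nf_num_def by (induction k) (simp_all add: nf_un_def)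
      ultimately show ?thesis using False h by (intro nf_law_special) auto
    qed
    moreover have "computable (\<lambda>n. n \<in> {N..})"
      unfolding atLeast_iff by (intro computable_intros)
    ultimately show ?thesis using C by (intro word_problem_of_laws)
  qed
qed

lemma solvable_word_problem_laws: "solvable_word_problem sig (variety sig laws)"
  unfolding solvable_word_problem_def
proof (intro allI impI)
  fix X :: "nat set" and R :: "nat equation set"
  assume "finite_presentation sig X R"
  then interpret presentation X R by unfold_locales
  show "\<exists>p. \<forall>s\<in>free_terms sig X. \<forall>t\<in>free_terms sig X.
      computes p [trm_code s, trm_code t]
        (of_bool ((s, t) \<in> word_congruence sig (variety sig laws :: nat algebra set) X R))"
    using word_problem unfolding \<theta>_def .
qed

section \<open>Recursiveness of the laws and failure of uniformity\<close>

definition chain_code :: "nat \<Rightarrow> nat \<Rightarrow> nat" where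
  "chain_code n m = (un_code 3 ^^ m) (un_code 2 ((un_code 1 ^^ n) (trm_code cst)))"

lemma trm_code_chain: "trm_code (chain n m) = chain_code n m"
  by (simp add: chain_def num_def chain_code_def trm_code_un trm_code_un_funpow
      del: trm_code.simps)

lemma computable_chain_code [computable_intros]:
  "computable n \<Longrightarrow> computable m \<Longrightarrow> computable (\<lambda>x. chain_code (n x) (m x))"
  unfolding chain_code_def by (intro computable_intros)

lemma chain_code_ge: "n \<le> chain_code n m" "m \<le> chain_code n m"
proof -
  let ?c = "(un_code 1 ^^ n) (trm_code cst)"
  have "m + un_code 2 ?c \<le> chain_code n m"
    unfolding chain_code_def by (rule un_code_funpow_ge)
  moreover have "?c < un_code 2 ?c" by (rule un_code_greater)
  moreover have "n + trm_code cst \<le> ?c" by (rule un_code_funpow_ge)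
  ultimately show "n \<le> chain_code n m" "m \<le> chain_code n m" by linarith+
qed

text \<open>Both indices of a law are bounded by the code of its left-hand side, so a bounded search
  decides membership.\<close>

lemma recursive_laws_laws: "recursive_laws laws"
proof -
  define D where "D c d \<longleftrightarrow> d = trm_code cst \<and> (c = un_code 3 (trm_code cst) \<or>
      (\<exists>n < Suc c. \<exists>m < Suc c. halts0 n m \<and> c = chain_code n (Suc m)))" for c d
  have "computable (\<lambda>z. of_bool (D (fst z) (snd z)) :: nat)"
    unfolding D_def by (intro computable_intros)
  then obtain p where p: "\<And>c d. computes p [c, d] (of_bool (D c d))"
    by (rule computes_of_computable2[where f = "\<lambda>c d. of_bool (D c d)"]) blast
  have bounds: "(\<exists>n m. halts0 n m \<and> c = chain_code n (Suc m)) \<longleftrightarrow>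
      (\<exists>n < Suc c. \<exists>m < Suc c. halts0 n m \<and> c = chain_code n (Suc m))" for c
  proof
    assume "\<exists>n m. halts0 n m \<and> c = chain_code n (Suc m)"
    then obtain n m where nm: "halts0 n m" "c = chain_code n (Suc m)" by blast
    then have "n < Suc c" "m < Suc c"
      using chain_code_ge[of n "Suc m"] chain_code_ge(2)[of "Suc m" n] by auto
    with nm show "\<exists>n < Suc c. \<exists>m < Suc c. halts0 n m \<and> c = chain_code n (Suc m)" by blast
  qed blast
  have "(s, t) \<in> laws \<longleftrightarrow> D (trm_code s) (trm_code t)" for s t
  proof -
    have "(s, t) \<in> laws \<longleftrightarrow> t = cst \<and> (s = un 3 cst \<or> (\<exists>n m. halts0 n m \<and> s = chain n (Suc m)))"
      by (auto simp: laws_def)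
    also have "\<dots> \<longleftrightarrow> trm_code t = trm_code cst \<and> (trm_code s = trm_code (un 3 cst) \<or>
        (\<exists>n m. halts0 n m \<and> trm_code s = trm_code (chain n (Suc m))))"
      by (simp only: trm_code_eq_iff)
    also have "\<dots> \<longleftrightarrow> D (trm_code s) (trm_code t)"
      unfolding D_def trm_code_un trm_code_chain bounds ..
    finally show ?thesis .
  qed
  then show ?thesis unfolding recursive_laws_def using p by (simp only:) blast
qed

text \<open>The presentation that stops the chain of \<open>n\<close> is computed from
  \<open>n\<close>; composed with this map, a uniform program would decide whether
  \<open>halts0 n m\<close> for some \<open>m\<close>.\<close>

lemma not_uniformly_solvable_word_problem_laws:
  "\<not> uniformly_solvable_word_problem sig (variety sig laws)"
proof
  assume "uniformly_solvable_word_problem sig (variety sig laws)"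
  then obtain p where p: "\<And>X R s t. finite_presentation sig X R \<Longrightarrow>
      s \<in> free_terms sig X \<Longrightarrow> t \<in> free_terms sig X \<Longrightarrow>
      computes p [set_encode X, set_encode (equation_code ` R), trm_code s, trm_code t]
        (of_bool ((s, t) \<in> word_congruence sig (variety sig laws :: nat algebra set) X R))"
    unfolding uniformly_solvable_word_problem_def by blast
  \<comment> \<open>A one-element set has a single binary digit 1, so its code is a power of
    2.\<close>
  define relation_code :: "nat \<Rightarrow> nat"
    where "relation_code n = 2 ^ prod_encode (chain_code n 1, chain_code n 0)" for n
  have relation_code: "set_encode (equation_code ` {(chain n 1, chain n 0)}) = relation_code n" for n
    by (simp add: relation_code_def equation_code_def trm_code_chain set_encode_def
        del: chain_simps One_nat_def)
  have p: "computes p [0, relation_code n, chain_code n 0, trm_code cst]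
      (of_bool (\<exists>m. halts0 n m))" for n
    using p[OF collapsed_chain_iff(1) chain_in_free_terms[of n 0] cst_in_free_terms, of n]
    unfolding relation_code collapsed_chain_iff(2) trm_code_chain by simp
  have "computable relation_code"
    unfolding relation_code_def by (intro computable_intros)
  then obtain q2 where q2: "\<And>n. computes q2 [n] (relation_code n)"
    by (rule computes_of_computable1) (rule that)
  have "computable (\<lambda>n. chain_code n 0)" by (intro computable_intros)
  then obtain q3 where q3: "\<And>n. computes q3 [n] (chain_code n 0)"
    by (rule computes_of_computable1) (rule that)
  obtain q4 where q4: "\<And>n. computes q4 [n] (trm_code cst)"
    by (rule computes_of_computable1[OF computable_const]) (rule that)
  \<comment> \<open>\<open>Zero\<close> supplies the code of the empty set of generators.\<close>
  have "computes (Comp p [Zero, q2, q3, q4]) [n] (of_bool (\<exists>m. halts0 n m))" for n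
    by (rule computes.Comp[OF _ p]) (simp add: q2 q3 q4 computes.Zero del: trm_code.simps)
  then show False using not_computes_halts0 by blast
qed

theorem theorem6p4:
  shows "\<exists>(\<Sigma> :: signature) (E :: nat equation set).
    finite (ops \<Sigma>) \<and>
    E \<subseteq> free_terms \<Sigma> {} \<times> free_terms \<Sigma> {} \<and>
    recursive_laws E \<and>
    solvable_word_problem \<Sigma> (variety \<Sigma> E) \<and>
    \<not> uniformly_solvable_word_problem \<Sigma> (variety \<Sigma> E)"
proof (intro exI conjI)
  show "finite (ops sig)" by (simp add: sig_def)
qed (rule laws_closed recursive_laws_laws solvable_word_problem_laws
    not_uniformly_solvable_word_problem_laws)+

end
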